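(* Let $X$ be an infinite discrete abelian group with Haar measure $\alpha$ and let $\hat X$ be its (compact) dual group with Haar measure $\hat\alpha$, normalized as in the context. For $0<p,q\le\infty$ let $C_{p,q}$ be the $(p,q)$-norm of the Fourier operator defined in the context. Consider the regions $$R_1'=\Big\{\Big(\tfrac1p,\tfrac1q\Big)\in[0,\infty)^2:\ \tfrac1p+\tfrac1q<1,\ \tfrac1q<\tfrac12\Big\},$$ $$R_2'=\Big\{\Big(\tfrac1p,\tfrac1q\Big)\in[0,\infty)^2:\ \tfrac1p+\tfrac1q\ge 1,\ \tfrac1p\ge\tfrac12\Big\},$$ $$R_3'=\Big\{\Big(\tfrac1p,\tfrac1q\Big)\in[0,1]^2:\ \tfrac1p<\tfrac12,\ \tfrac1q\ge\tfrac12\Big\}.$$ Then $$C_{p,q}=\begin{cases}\infty & \text{if } (1/p,1/q)\in R_1'\cup R_3',\\ \hat\alpha(\hat X)^{1/p+1/q-1} & \text{if } (1/p,1/q)\in R_2'.\end{cases}$$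
   Context: For a locally compact abelian group $X$ with Haar measure $\alpha$, $\hat X$ denotes the group of continuous homomorphisms $\gamma:X\to\mathbb T$ under pointwise multiplication, and the Fourier transform of $f\in L^1(X)$ is $\hat f(\gamma)=\int_X f(x)\overline{\gamma(x)}\,\alpha(dx)$, extended to $L^2(X)$ by the Plancherel theorem. When $X$ is discrete, $\alpha$ gives the same mass $c>0$ to every point, $\hat X$ is compact, and $\hat\alpha$ is the Haar measure on $\hat X$ with total mass $\hat\alpha(\hat X)=1/c$ (the normalization for which Fourier inversion and $\|f\|_2=\|\hat f\|_2$ hold). For $0<p<\infty$, $\|f\|_p=(\int|f|^p)^{1/p}$ (a quasi-norm if $p<1$), $\|f\|_\infty$ is the essential supremum, and $1/\infty=0$. For discrete $X$, $C_{p,q}:=\sup\{\|\hat f\|_{L^q(\hat X,\hat\alpha)}: f\in L^2(X)\cap L^p(X),\ \|f\|_{L^p(X,\alpha)}=1\}$ (note $L^2\cap L^p=L^p$ if $p\le 2$ and $=L^2$ if $p>2$). *)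

theory Defs
  imports "HOL-Analysis.Analysis" "HOL-Probability.Essential_Supremum"
begin

text \<open>L^s quasi-norm parametrised by the reciprocal exponent a = 1/s (a = 0 means s = infinity).\<close>
definition Lnorm :: "'b measure \<Rightarrow> real \<Rightarrow> ('b \<Rightarrow> complex) \<Rightarrow> ennreal" where
  "Lnorm M a f =
     (if a = 0 then esssup M (\<lambda>x. ennreal (norm (f x)))
      else (let I = (\<integral>\<^sup>+ x. ennreal (norm (f x) powr (1 / a)) \<partial>M)
            in if I = \<infinity> then \<infinity> else ennreal (enn2real I powr a)))"

definition haarX :: "real \<Rightarrow> 'a measure" where
  "haarX c = scale_measure (ennreal c) (count_space UNIV)"

definition dual_group :: "('a::ab_group_add \<Rightarrow> complex) set" where
  "dual_group = {\<gamma>. (\<forall>x. norm (\<gamma> x) = 1) \<and> (\<forall>x y. \<gamma> (x + y) = \<gamma> x * \<gamma> y)}"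

text \<open>Normalised Haar measure on the dual (on the sigma-algebra generated by the evaluations,
  i.e. the Baire sets of the compact group), with total mass 1/c.\<close>
definition is_dual_haar :: "real \<Rightarrow> ('a::ab_group_add \<Rightarrow> complex) measure \<Rightarrow> bool" where
  "is_dual_haar c \<mu> \<longleftrightarrow>
     space \<mu> = dual_group \<and>
     sets \<mu> = sigma_sets dual_group {{\<gamma>\<in>dual_group. \<gamma> x \<in> U} | x U. open U} \<and>
     (\<forall>\<eta>\<in>dual_group. \<forall>A\<in>sets \<mu>.
        emeasure \<mu> ((\<lambda>\<gamma>. \<lambda>y. \<eta> y * \<gamma> y) -` A \<inter> dual_group) = emeasure \<mu> A) \<and>
     emeasure \<mu> dual_group = ennreal (1 / c)"

text \<open>Fourier transform on L^2(X) (Plancherel extension): g is the L^2(\<mu>)-limit of the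
  transforms of the finitely supported truncations of f.\<close>
definition is_fourier :: "real \<Rightarrow> ('a::ab_group_add \<Rightarrow> complex) measure \<Rightarrow> ('a \<Rightarrow> complex)
      \<Rightarrow> (('a \<Rightarrow> complex) \<Rightarrow> complex) \<Rightarrow> bool" where
  "is_fourier c \<mu> f g \<longleftrightarrow>
     g \<in> borel_measurable \<mu> \<and> Lnorm \<mu> (1/2) g < \<infinity> \<and>
     ((\<lambda>F. \<integral>\<^sup>+ \<gamma>. ennreal ((norm (g \<gamma> - (\<Sum>x\<in>F. complex_of_real c * f x * cnj (\<gamma> x))))\<^sup>2) \<partial>\<mu>)
        \<longlongrightarrow> 0) (finite_subsets_at_top UNIV)"

definition Cpq :: "real \<Rightarrow> ('a::ab_group_add \<Rightarrow> complex) measure \<Rightarrow> real \<Rightarrow> real \<Rightarrow> ennreal" where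
  "Cpq c \<mu> a b = Sup {Lnorm \<mu> b g | f g.
      Lnorm (haarX c) (1/2) f < \<infinity> \<and> Lnorm (haarX c) a f = 1 \<and> is_fourier c \<mu> f g}"

end

theory Submission
  imports Defs "HOL-Complex_Analysis.Conformal_Mappings"
begin

text \<open>Upper bound: for finitely supported \<open>f\<close> and \<open>1/2 \<le> a < 1\<close> the Hausdorff--Young inequality
  follows from Plancherel and the trivial \<open>L\<^sup>1\<close>--\<open>L\<^sup>\<infinity>\<close> bound by the three lines theorem; for \<open>a \<ge> 1\<close> it is
  the inclusion of \<open>\<ell>\<^sup>p\<close> in \<open>\<ell>\<^sup>1\<close>. Hoelder's inequality on the finite measure \<open>\<mu>\<close> gives all larger \<open>b\<close>,
  and Fatou's lemma along almost everywhere convergent truncations removes the support condition.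
  A point mass attains the bound.

  Divergence: test indicators of sets \<open>E\<close> with \<open>N\<close> elements, whose transform has fourth moment
  proportional to the additive energy of \<open>E\<close>. If the energy is \<open>O(N\<^sup>2)\<close>, the first moment is at least of
  order \<open>N\<^bsup>1/2\<^esup>\<close>, which beats \<open>N\<^sup>a\<close> for \<open>a < 1/2\<close>. If the energy is of order \<open>N\<^sup>3\<close> (arithmetic progressions
  or finite subgroups), the \<open>L\<^bsup>1/b\<^esup>\<close> norm is of order \<open>N\<^bsup>1-b\<^esup>\<close> for \<open>b < 1/2\<close>, which beats \<open>N\<^sup>a\<close>
  for \<open>a + b < 1\<close>.\<close>

subsection \<open>Characters separate points\<close>

text \<open>\<open>\<mu>\<close> is known only through its invariance and total mass, so the
  orthogonality of characters, which underlies Plancherel and all moments, has to come from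
  invariance: translating by \<eta> multiplies the integral of \<gamma>(x) by \<eta>(x), so the
  integral vanishes once some \<eta>(x) differs from 1. Producing such an \<eta> in an arbitrary
  abelian group is an extension argument that uses the divisibility of the circle. With these
  normalizations both endpoint estimates have constant 1, hence so does every point of a + b = 1
  with 1/2 <= a <= 1. The factor (1/c)^(a+b-1) comes only from the inclusions of l^p in l^1 and of
  the spaces over \<open>\<mu>\<close>. Neither family of test sets suffices alone: the first moment
  of a low-energy set gives growth N^(1/2-a), which is empty for a >= 1/2, and the high-energy bound
  gives N^(1-a-b), which is empty for a + b >= 1. Both families must exist in every infinite abelian
  group; for high energy this forces a distinction between groups with an element of infinite order
  and torsion groups.\<close>

definition partial_char :: "('a::ab_group_add \<times> complex) set \<Rightarrow> bool" where
  "partial_char G \<longleftrightarrow> (0, 1) \<in> G \<and> (\<forall>x u y v. (x, u) \<in> G \<longrightarrow> (y, v) \<in> G \<longrightarrow> (x - y, u / v) \<in> G)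
     \<and> (\<forall>u. (0, u) \<in> G \<longrightarrow> u = 1) \<and> (\<forall>x u. (x, u) \<in> G \<longrightarrow> norm u = 1)"

lemma partial_charD:
  assumes "partial_char G"
  shows "(0, 1) \<in> G" "(x, u) \<in> G \<Longrightarrow> (y, v) \<in> G \<Longrightarrow> (x - y, u / v) \<in> G"
    "(0, u) \<in> G \<Longrightarrow> u = 1" "(x, u) \<in> G \<Longrightarrow> norm u = 1"
  using assms unfolding partial_char_def by blast+

lemma partial_char_add:
  assumes "partial_char G" "(x, u) \<in> G" "(y, v) \<in> G"
  shows "(x + y, u * v) \<in> G"
proof -
  have "(0 - y, 1 / v) \<in> G" using assms partial_charD by blast
  then have "(x - (0 - y), u / (1 / v)) \<in> G" using assms partial_charD by blast
  then show ?thesis by simp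
qed

text \<open>A partial character is encoded as its graph, a subgroup of X times the circle, so that
  unions of chains are plain set unions. Two values at one point differ by a value at 0, so the
  clause at 0 makes the relation single-valued.\<close>

lemma partial_char_unique:
  assumes "partial_char G" "(x, u) \<in> G" "(x, v) \<in> G"
  shows "u = v"
proof -
  have "(x - x, u / v) \<in> G" using assms partial_charD by blast
  then have "u / v = 1" using assms partial_charD(3)[of G "u / v"] by simp
  then show ?thesis by auto
qed

definition nmul :: "nat \<Rightarrow> 'a::ab_group_add \<Rightarrow> 'a" where
  "nmul n x = (\<Sum>i<n. x)"

lemma nmul_0 [simp]: "nmul 0 x = 0" and nmul_1 [simp]: "nmul (Suc 0) x = x"
  and nmul_Suc: "nmul (Suc n) x = nmul n x + x"
  by (simp_all add: nmul_def)

lemma nmul_add: "nmul (m + n) x = nmul m x + nmul n x"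
  by (induction n) (simp_all add: nmul_Suc algebra_simps)

lemma nmul_mult: "nmul (m * n) x = nmul m (nmul n x)"
  by (induction m) (simp_all add: nmul_Suc nmul_add algebra_simps)

lemma partial_char_nmul:
  assumes "partial_char G" "(x, u) \<in> G"
  shows "(nmul n x, u ^ n) \<in> G"
proof (induction n)
  case 0
  then show ?case using partial_charD(1)[OF assms(1)] by simp
next
  case (Suc n)
  then show ?case using partial_char_add[OF assms(1) Suc assms(2)] by (simp add: nmul_Suc mult.commute)
qed

text \<open>There are n >= 2 distinct n-th roots of u, so at least one is not 1. This freedom is
  what later lets a character be nontrivial at a prescribed point.\<close>

lemma unit_root_neq_1:
  fixes u :: complex
  assumes "norm u = 1" "n \<ge> 2"
  obtains w where "w ^ n = u" "norm w = 1" "w \<noteq> 1"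
proof -
  have c: "card {z::complex. z ^ n = u} = n"
    using assms by (intro card_nth_roots) auto
  have "\<not> {z::complex. z ^ n = u} \<subseteq> {1}"
  proof
    assume "{z::complex. z ^ n = u} \<subseteq> {1}"
    then have "card {z::complex. z ^ n = u} \<le> card {1::complex}"
      by (intro card_mono) auto
    then show False using c assms by simp
  qed
  then obtain w where w: "w ^ n = u" "w \<noteq> 1" by blast
  have "norm w ^ n = 1" using w assms by (metis norm_power)
  then have "norm w = 1" using assms power_eq_imp_eq_base[of "norm w" n 1] by simp
  with w that show ?thesis by blast
qed

text \<open>The extension is the subgroup generated by \<open>G\<close> and \<open>(y, w)\<close>;
  integer multiples of \<open>y\<close> are written as differences of natural ones. Only the clause
  at 0 can fail: a relation between \<open>h\<close> and multiples of \<open>y\<close> makes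
  \<open>h\<close> or its negative a natural multiple of \<open>y\<close>, depending on the sign of
  i - j, and then \<open>compat\<close> forces the value 1.\<close>

lemma partial_char_adjoin:
  fixes G :: "('a::ab_group_add \<times> complex) set"
  assumes G: "partial_char G" and w: "norm w = 1"
    and compat: "\<And>k u. (nmul k y, u) \<in> G \<Longrightarrow> w ^ k = u"
  obtains G' where "partial_char G'" "G \<subseteq> G'" "(y, w) \<in> G'"
proof
  let ?G = "{(h + nmul i y - nmul j y, u * w ^ i / w ^ j) | h u i j. (h, u) \<in> G}"
  have [simp]: "w \<noteq> 0" using w by auto
  have one: "u * w ^ i / w ^ j = 1" if "(h, u) \<in> G" "h + nmul i y - nmul j y = 0" for h u i j
  proof (cases "i \<le> j")
    case True
    then obtain k where k: "j = i + k" using le_Suc_ex by blast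
    have "h = nmul k y" using that k by (simp add: nmul_add algebra_simps)
    then have "w ^ k = u" using compat that by blast
    moreover have "u \<noteq> 0" using that(1) partial_charD(4)[OF G that(1)] by auto
    ultimately show ?thesis using k by (simp add: power_add)
  next
    case False
    then obtain k where k: "i = j + k" using le_Suc_ex by (metis nat_le_linear)
    have "h + nmul k y = 0" using that k by (simp add: nmul_add algebra_simps)
    then have "0 - h = nmul k y" by (simp add: neg_eq_iff_add_eq_0)
    then have "(nmul k y, 1 / u) \<in> G" using partial_charD(2)[OF G partial_charD(1)[OF G] that(1)] by simp
    then have "w ^ k = 1 / u" by (rule compat)
    moreover have "u \<noteq> 0" using that(1) partial_charD(4)[OF G that(1)] by auto
    ultimately show ?thesis using k by (simp add: power_add)
  qed
  show "partial_char ?G"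
    unfolding partial_char_def
  proof (intro conjI allI impI)
    show "(0, 1) \<in> ?G" using partial_charD(1)[OF G] by (auto intro!: exI[of _ 0] exI[of _ "1::complex"])
  next
    fix x u x' u' assume "(x, u) \<in> ?G" "(x', u') \<in> ?G"
    then obtain h v i j h' v' i' j' where e:
      "x = h + nmul i y - nmul j y" "u = v * w ^ i / w ^ j" "(h, v) \<in> G"
      "x' = h' + nmul i' y - nmul j' y" "u' = v' * w ^ i' / w ^ j'" "(h', v') \<in> G"
      by blast
    have "(h - h', v / v') \<in> G" using e G partial_charD by blast
    moreover have "x - x' = (h - h') + nmul (i + j') y - nmul (j + i') y"
      unfolding e(1,4) by (simp add: nmul_add algebra_simps)
    moreover have "u / u' = (v / v') * w ^ (i + j') / w ^ (j + i')"
      unfolding e(2,5) by (simp add: power_add field_simps)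
    ultimately show "(x - x', u / u') \<in> ?G" by blast
  next
    fix u assume "(0, u) \<in> ?G"
    then show "u = 1" using one by auto
  next
    fix x u assume "(x, u) \<in> ?G"
    then show "norm u = 1" using w partial_charD(4)[OF G]
      by (auto simp: norm_mult norm_divide norm_power)
  qed
  show "G \<subseteq> ?G"
  proof clarify
    fix h u assume "(h, u) \<in> G"
    then show "\<exists>h' u' i j. (h, u) = (h' + nmul i y - nmul j y, u' * w ^ i / w ^ j) \<and> (h', u') \<in> G"
      by (intro exI[of _ h] exI[of _ u] exI[of _ 0]) auto
  qed
  show "(y, w) \<in> ?G"
    using partial_charD(1)[OF G]
    by (intro CollectI exI[of _ 0] exI[of _ "1::complex"] exI[of _ "Suc 0"]) (auto intro!: exI[of _ 0])
qed

text \<open>If no positive multiple of \<open>y\<close> is in the domain, every unimodular value is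
  admissible and -1 is taken. Otherwise let n be least with n y in the domain; then \<open>w\<close>
  has to be an n-th root of the value already given there, and n >= 2 because \<open>y\<close>
  itself is outside the domain.\<close>

lemma partial_char_extend:
  fixes G :: "('a::ab_group_add \<times> complex) set"
  assumes G: "partial_char G" and y: "y \<notin> Domain G"
  obtains G' w where "partial_char G'" "G \<subseteq> G'" "(y, w) \<in> G'" "w \<noteq> 1"
proof -
  have "\<exists>w. norm w = 1 \<and> w \<noteq> 1 \<and> (\<forall>k u. (nmul k y, u) \<in> G \<longrightarrow> w ^ k = u)"
  proof (cases "\<exists>n>0. nmul n y \<in> Domain G")
    case False
    have "w ^ k = u" if "(nmul k y, u) \<in> G" for k u and w :: complex
    proof -
      have "k = 0" using False that by (metis DomainI gr0I)
      then show ?thesis using that partial_charD(3)[OF G, of u] by simp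
    qed
    then show ?thesis by (intro exI[of _ "-1"]) auto
  next
    case True
    define n where "n = (LEAST n. n > 0 \<and> nmul n y \<in> Domain G)"
    have n: "n > 0" "nmul n y \<in> Domain G"
      using LeastI_ex[OF True] unfolding n_def by auto
    have least: "m = 0" if "m < n" "nmul m y \<in> Domain G" for m
      using not_less_Least[OF that(1)[unfolded n_def]] that by auto
    obtain u0 where u0: "(nmul n y, u0) \<in> G" using n by auto
    have "n \<noteq> 1" using n y by auto
    then have "n \<ge> 2" using n by auto
    then obtain w where w: "w ^ n = u0" "norm w = 1" "w \<noteq> 1"
      using unit_root_neq_1 partial_charD(4)[OF G u0] by blast
    \<comment> \<open>By minimality of \<open>n\<close> the multiples of \<open>y\<close> in the
      domain are exactly the multiples of \<open>nmul n y\<close>: the remainder of \<open>k\<close>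
      modulo \<open>n\<close> would give a smaller one.\<close>
    have "w ^ k = u" if k: "(nmul k y, u) \<in> G" for k u
    proof -
      let ?q = "k div n" let ?r = "k mod n"
      have 1: "(nmul (?q * n) y, u0 ^ ?q) \<in> G"
        using partial_char_nmul[OF G u0, of ?q] by (simp add: nmul_mult)
      have "nmul k y - nmul (?q * n) y = nmul ?r y"
        by (metis add_diff_cancel_left' div_mult_mod_eq nmul_add)
      then have "nmul ?r y \<in> Domain G"
        using partial_charD(2)[OF G k 1] by (metis Domain.DomainI)
      then have "?r = 0" using least n by simp
      then have "k = ?q * n" by (metis add.right_neutral div_mult_mod_eq)
      then have "u = u0 ^ ?q" using partial_char_unique[OF G k] 1 by metis
      then show ?thesis using w \<open>k = ?q * n\<close> by (metis power_mult mult.commute)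
    qed
    then show ?thesis using w by blast
  qed
  then obtain w where w: "norm w = 1" "w \<noteq> 1" "\<And>k u. (nmul k y, u) \<in> G \<Longrightarrow> w ^ k = u" by blast
  obtain G' where "partial_char G'" "G \<subseteq> G'" "(y, w) \<in> G'"
    using w(1,3) by (rule partial_char_adjoin[OF G])
  then show ?thesis using w(2) by (rule that)
qed

lemma partial_char_Union:
  assumes C: "subset.chain {G. partial_char G} C" "C \<noteq> {}"
  shows "partial_char (\<Union>C)"
proof -
  have pc: "partial_char G" if "G \<in> C" for G
    using C that by (auto simp: subset.chain_def)
  have two: "\<exists>G\<in>C. p \<in> G \<and> q \<in> G" if "p \<in> \<Union>C" "q \<in> \<Union>C" for p q
    using C that unfolding subset.chain_def by blast
  have "(0, 1) \<in> \<Union>C" using C(2) pc partial_charD(1) by blast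
  moreover have "(x - y, u / v) \<in> \<Union>C" if xy: "(x, u) \<in> \<Union>C" "(y, v) \<in> \<Union>C" for x u y v
  proof -
    obtain G where G: "G \<in> C" "(x, u) \<in> G" "(y, v) \<in> G" using two[OF xy] by blast
    then have "(x - y, u / v) \<in> G" using partial_charD(2)[OF pc] by blast
    then show ?thesis using G(1) by blast
  qed
  moreover have "u = 1" if "(0, u) \<in> \<Union>C" for u using that partial_charD(3)[OF pc] by blast
  moreover have "norm u = 1" if "(x, u) \<in> \<Union>C" for x u using that partial_charD(4)[OF pc] by blast
  ultimately show ?thesis unfolding partial_char_def by blast
qed

text \<open>Zorn's lemma is applied only above \<open>G0\<close>, which already assigns a value
  other than 1 to \<open>x\<close>. A maximal extension has full domain, since any missing point
  could be adjoined, and its graph defines the character.\<close>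

lemma dual_group_separates:
  fixes x :: "'a::ab_group_add"
  assumes "x \<noteq> 0"
  obtains \<eta> where "\<eta> \<in> dual_group" "\<eta> x \<noteq> 1"
proof -
  have "partial_char {(0 :: 'a, 1)}" by (auto simp: partial_char_def)
  then obtain G0 w where G0: "partial_char G0" "(x, w) \<in> G0" "w \<noteq> 1"
    by (rule partial_char_extend[where y = x]) (use assms in auto)
  let ?A = "{G. partial_char G \<and> G0 \<subseteq> G}"
  have "\<exists>M\<in>?A. \<forall>X\<in>?A. M \<subseteq> X \<longrightarrow> X = M"
  proof (rule subset_Zorn_nonempty)
    show "?A \<noteq> {}" using G0 by blast
  next
    fix C assume C: "C \<noteq> {}" "subset.chain ?A C"
    have "subset.chain {G. partial_char G} C" using C by (auto simp: subset.chain_def)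
    then have "partial_char (\<Union>C)" using partial_char_Union C(1) by blast
    moreover obtain G where "G \<in> C" using C(1) by blast
    moreover have "G0 \<subseteq> G" using C(2) \<open>G \<in> C\<close> by (auto simp: subset.chain_def)
    ultimately show "\<Union>C \<in> ?A" by blast
  qed
  then obtain M where M: "partial_char M" "G0 \<subseteq> M"
    and M_max: "\<forall>X\<in>?A. M \<subseteq> X \<longrightarrow> X = M" by blast
  have max: "X = M" if "partial_char X" "M \<subseteq> X" for X using M_max M that by blast
  have dom: "\<exists>u. (y, u) \<in> M" for y
  proof (rule ccontr)
    assume "\<nexists>u. (y, u) \<in> M"
    then have "y \<notin> Domain M" by auto
    then obtain G' v where "partial_char G'" "M \<subseteq> G'" "(y, v) \<in> G'"
      by (rule partial_char_extend[OF M(1)])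
    then show False using max \<open>y \<notin> Domain M\<close> by blast
  qed
  define \<eta> where "\<eta> y = (THE u. (y, u) \<in> M)" for y
  have in_M: "(y, \<eta> y) \<in> M" for y
    unfolding \<eta>_def by (rule theI') (use dom partial_char_unique[OF M(1)] in blast)
  have "\<eta> \<in> dual_group"
    unfolding dual_group_def mem_Collect_eq
  proof (intro conjI allI)
    fix y z
    show "norm (\<eta> y) = 1" by (rule partial_charD(4)[OF M(1) in_M])
    show "\<eta> (y + z) = \<eta> y * \<eta> z"
      by (rule partial_char_unique[OF M(1) in_M partial_char_add[OF M(1) in_M in_M]])
  qed
  moreover have "\<eta> x = w"
    by (rule partial_char_unique[OF M(1) in_M]) (use G0 M in blast)
  ultimately show ?thesis using that G0 by blast
qed

subsection \<open>Moments of exponential sums\<close>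

lemma dual_groupD:
  assumes "\<gamma> \<in> dual_group"
  shows "norm (\<gamma> x) = 1" "\<gamma> (x + y) = \<gamma> x * \<gamma> y"
  using assms by (auto simp: dual_group_def)

lemma dual_group_0: "\<gamma> \<in> dual_group \<Longrightarrow> \<gamma> 0 = 1"
  using dual_groupD(1)[of \<gamma> 0] dual_groupD(2)[of \<gamma> 0 0] by auto

lemma dual_group_minus: "\<gamma> \<in> dual_group \<Longrightarrow> \<gamma> (- x) = cnj (\<gamma> x)"
proof -
  assume g: "\<gamma> \<in> dual_group"
  then have "\<gamma> x * \<gamma> (- x) = 1" using dual_groupD(2)[OF g, of x "-x"] dual_group_0[OF g] by simp
  moreover have "\<gamma> x * cnj (\<gamma> x) = 1"
    using dual_groupD(1)[OF g, of x] by (simp add: complex_norm_square[symmetric])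
  ultimately show ?thesis by (metis mult_cancel_left mult_zero_left zero_neq_one)
qed

lemma dual_group_diff: "\<gamma> \<in> dual_group \<Longrightarrow> \<gamma> (x - y) = \<gamma> x * cnj (\<gamma> y)"
  using dual_groupD(2)[of \<gamma> x "-y"] by (simp add: dual_group_minus)

lemma dual_group_mult:
  "\<eta> \<in> dual_group \<Longrightarrow> \<gamma> \<in> dual_group \<Longrightarrow> (\<lambda>y. \<eta> y * \<gamma> y) \<in> dual_group"
  by (auto simp: dual_group_def norm_mult)

text \<open>The additive energy: the equation x + z = y + w is written in the shape in which it
  appears as the argument of \<gamma> when the fourth power of an exponential sum is
  expanded.\<close>

definition energy :: "'a::ab_group_add set \<Rightarrow> nat" where
  "energy E = card {((x, y), (z, w)). x \<in> E \<and> y \<in> E \<and> z \<in> E \<and> w \<in> E \<and> x - y + (z - w) = 0}"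

section \<open>Haar measure on the dual: orthogonality, Parseval, fourth moments\<close>

locale dual_haar =
  fixes c :: real and \<mu> :: "('a::ab_group_add \<Rightarrow> complex) measure"
  assumes c_pos: "c > 0" and haar: "is_dual_haar c \<mu>"
begin

lemma space_haar [simp]: "space \<mu> = dual_group"
  and sets_haar: "sets \<mu> = sigma_sets dual_group {{\<gamma>\<in>dual_group. \<gamma> x \<in> U} | x U. open U}"
  and emeasure_space_haar: "emeasure \<mu> dual_group = ennreal (1 / c)"
  and emeasure_translate: "\<eta> \<in> dual_group \<Longrightarrow> A \<in> sets \<mu> \<Longrightarrow>
        emeasure \<mu> ((\<lambda>\<gamma>. \<lambda>y. \<eta> y * \<gamma> y) -` A \<inter> dual_group) = emeasure \<mu> A"
  using haar by (auto simp: is_dual_haar_def)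

sublocale finite_measure \<mu>
  by standard (simp add: emeasure_space_haar)

lemma measure_space_haar: "measure \<mu> dual_group = 1 / c"
  using emeasure_space_haar c_pos by (simp add: measure_def)

lemma measurable_eval [measurable]: "(\<lambda>\<gamma>. \<gamma> x) \<in> borel_measurable \<mu>"
proof (rule borel_measurableI)
  fix U :: "complex set" assume "open U"
  have "(\<lambda>\<gamma>. \<gamma> x) -` U \<inter> space \<mu> = {\<gamma>\<in>dual_group. \<gamma> x \<in> U}" by auto
  then show "(\<lambda>\<gamma>. \<gamma> x) -` U \<inter> space \<mu> \<in> sets \<mu>"
    using \<open>open U\<close> by (auto simp: sets_haar)
qed

lemma measurable_translate:
  assumes "\<eta> \<in> dual_group"
  shows "(\<lambda>\<gamma>. \<lambda>y. \<eta> y * \<gamma> y) \<in> measurable \<mu> \<mu>"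
proof (rule measurable_sigma_sets[OF sets_haar])
  show "{{\<gamma> \<in> dual_group. \<gamma> x \<in> U} |x U. open U} \<subseteq> Pow dual_group" by auto
  show "(\<lambda>\<gamma> y. \<eta> y * \<gamma> y) \<in> space \<mu> \<rightarrow> dual_group"
    using assms by (auto intro: dual_group_mult)
next
  fix A :: "('a \<Rightarrow> complex) set"
  assume "A \<in> {{\<gamma> \<in> dual_group. \<gamma> x \<in> U} |x U. open U}"
  then obtain x U where A: "A = {\<gamma> \<in> dual_group. \<gamma> x \<in> U}" "open U" by blast
  have "(\<lambda>\<gamma> y. \<eta> y * \<gamma> y) -` A \<inter> space \<mu> = (\<lambda>\<gamma>. \<eta> x * \<gamma> x) -` U \<inter> space \<mu>"
    using assms by (auto simp: A intro: dual_group_mult)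
  also have "\<dots> \<in> sets \<mu>"
    by (rule measurable_sets[of _ _ borel]) (use A in auto)
  finally show "(\<lambda>\<gamma> y. \<eta> y * \<gamma> y) -` A \<inter> space \<mu> \<in> sets \<mu>" .
qed

lemma distr_translate:
  assumes "\<eta> \<in> dual_group"
  shows "distr \<mu> \<mu> (\<lambda>\<gamma>. \<lambda>y. \<eta> y * \<gamma> y) = \<mu>"
  by (rule measure_eqI)
     (simp_all add: emeasure_distr[OF measurable_translate[OF assms]] emeasure_translate[OF assms])

lemma integrable_bounded_haar:
  fixes f :: "('a \<Rightarrow> complex) \<Rightarrow> 'b::{banach, second_countable_topology}"
  assumes "f \<in> borel_measurable \<mu>" "\<And>\<gamma>. \<gamma> \<in> dual_group \<Longrightarrow> norm (f \<gamma>) \<le> B"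
  shows "integrable \<mu> f"
  by (rule integrable_const_bound[where B = B]) (use assms in auto)

lemma integrable_eval [simp]: "integrable \<mu> (\<lambda>\<gamma>. \<gamma> x)"
  by (rule integrable_bounded_haar[where B = 1]) (auto simp: dual_groupD)

lemma integral_eval: "(\<integral>\<gamma>. \<gamma> x \<partial>\<mu>) = (if x = 0 then of_real (1 / c) else 0)"
proof (cases "x = 0")
  case True
  have "(\<integral>\<gamma>. \<gamma> (0::'a) \<partial>\<mu>) = (\<integral>\<gamma>. 1 \<partial>\<mu>)"
    by (rule Bochner_Integration.integral_cong) (auto simp: dual_group_0)
  then show ?thesis using True by (simp add: measure_space_haar scaleR_conv_of_real)
next
  case False
  then obtain \<eta> where \<eta>: "\<eta> \<in> dual_group" "\<eta> x \<noteq> 1" by (rule dual_group_separates)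
  have "(\<integral>\<gamma>. \<gamma> x \<partial>\<mu>) = (\<integral>\<gamma>. \<gamma> x \<partial>distr \<mu> \<mu> (\<lambda>\<gamma>. \<lambda>y. \<eta> y * \<gamma> y))"
    by (simp add: distr_translate \<eta>)
  also have "\<dots> = (\<integral>\<gamma>. \<eta> x * \<gamma> x \<partial>\<mu>)"
    by (rule integral_distr[OF measurable_translate[OF \<eta>(1)] measurable_eval])
  also have "\<dots> = \<eta> x * (\<integral>\<gamma>. \<gamma> x \<partial>\<mu>)" by simp
  finally show ?thesis using \<eta> False by simp
qed

lemma integral_sum_eval:
  assumes "finite I"
  shows "(\<integral>\<gamma>. (\<Sum>i\<in>I. k i * \<gamma> (d i)) \<partial>\<mu>) = (\<Sum>i\<in>I. if d i = 0 then k i / of_real c else 0)"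
proof -
  have "(\<integral>\<gamma>. (\<Sum>i\<in>I. k i * \<gamma> (d i)) \<partial>\<mu>) = (\<Sum>i\<in>I. \<integral>\<gamma>. k i * \<gamma> (d i) \<partial>\<mu>)"
    by (rule Bochner_Integration.integral_sum) simp
  also have "\<dots> = (\<Sum>i\<in>I. if d i = 0 then k i / of_real c else 0)"
    by (rule sum.cong) (auto simp: integral_eval)
  finally show ?thesis .
qed

text \<open>The Fourier transform of \<open>f\<close> cut off to \<open>E\<close>; the factor
  \<open>c\<close> is the mass of a point, so these are the truncations occurring in
  \<open>is_fourier\<close>.\<close>

definition transform :: "'a set \<Rightarrow> ('a \<Rightarrow> complex) \<Rightarrow> ('a \<Rightarrow> complex) \<Rightarrow> complex" where
  "transform E f \<gamma> = (\<Sum>x\<in>E. complex_of_real c * f x * cnj (\<gamma> x))"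

lemma measurable_transform [measurable]: "transform E f \<in> borel_measurable \<mu>"
proof -
  have [measurable]: "cnj \<in> borel_measurable borel"
    by (intro borel_measurable_continuous_onI continuous_intros)
  show ?thesis unfolding transform_def[abs_def] by measurable
qed

lemma norm_transform_le:
  assumes "\<gamma> \<in> dual_group"
  shows "norm (transform E f \<gamma>) \<le> c * (\<Sum>x\<in>E. norm (f x))"
  unfolding transform_def sum_distrib_left
  by (rule sum_norm_le) (use c_pos dual_groupD[OF assms] in \<open>auto simp: norm_mult\<close>)

text \<open>Orthogonality leaves the diagonal of the double sum. Of the c^2 coming from the two
  transforms, one factor is cancelled by the total mass 1/c.\<close>

lemma parseval:
  assumes "finite E"
  shows "(\<integral>\<gamma>. (norm (transform E f \<gamma>))\<^sup>2 \<partial>\<mu>) = c * (\<Sum>x\<in>E. (norm (f x))\<^sup>2)"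
proof -
  have "complex_of_real (\<integral>\<gamma>. (norm (transform E f \<gamma>))\<^sup>2 \<partial>\<mu>)
      = (\<integral>\<gamma>. of_real ((norm (transform E f \<gamma>))\<^sup>2) \<partial>\<mu>)"
    by (simp del: of_real_power)
  also have "\<dots> = (\<integral>\<gamma>. (\<Sum>(x, y)\<in>E \<times> E. (of_real c)\<^sup>2 * f x * cnj (f y) * \<gamma> (y - x)) \<partial>\<mu>)"
  proof (rule Bochner_Integration.integral_cong[OF refl])
    fix \<gamma> assume "\<gamma> \<in> space \<mu>"
    then have g: "\<gamma> \<in> dual_group" by simp
    show "of_real ((norm (transform E f \<gamma>))\<^sup>2)
        = (\<Sum>(x, y)\<in>E \<times> E. (of_real c)\<^sup>2 * f x * cnj (f y) * \<gamma> (y - x))"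
      unfolding complex_norm_square transform_def cnj_sum sum_product sum.cartesian_product
      by (rule sum.cong) (auto simp: dual_group_diff[OF g] power2_eq_square)
  qed
  also have "\<dots> = (\<Sum>(x, y)\<in>E \<times> E. if y - x = 0 then (of_real c)\<^sup>2 * f x * cnj (f y) / of_real c else 0)"
    using integral_sum_eval[of "E \<times> E" "\<lambda>i. (of_real c)\<^sup>2 * f (fst i) * cnj (f (snd i))"
        "\<lambda>i. snd i - fst i"] assms
    by (simp add: case_prod_unfold)
  also have "\<dots> = (\<Sum>x\<in>E. \<Sum>y\<in>E. if y = x then of_real c * f x * cnj (f x) else 0)"
    unfolding sum.cartesian_product
    by (rule sum.cong) (use c_pos in \<open>auto simp: power2_eq_square\<close>)
  also have "\<dots> = (\<Sum>x\<in>E. of_real c * f x * cnj (f x))"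
    using assms by (simp add: sum.delta)
  also have "\<dots> = of_real (c * (\<Sum>x\<in>E. (norm (f x))\<^sup>2))"
    by (simp add: sum_distrib_left complex_norm_square mult.assoc del: of_real_power)
  finally show ?thesis by (simp only: of_real_eq_iff)
qed

text \<open>The fourth power is the square of the double sum for |S|^2, a sum of \<gamma>(x - y + (z
  - w)) over quadruples; integration counts those with vanishing argument, each with weight
  1/c.\<close>

lemma fourth_moment:
  assumes "finite E"
  shows "(\<integral>\<gamma>. (norm (\<Sum>x\<in>E. \<gamma> x)) ^ 4 \<partial>\<mu>) = real (energy E) / c"
proof -
  let ?I = "(E \<times> E) \<times> (E \<times> E)"
  let ?d = "\<lambda>((x, y), (z, w)). x - y + (z - w) :: 'a"
  have "complex_of_real (\<integral>\<gamma>. (norm (\<Sum>x\<in>E. \<gamma> x)) ^ 4 \<partial>\<mu>)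
      = (\<integral>\<gamma>. of_real ((norm (\<Sum>x\<in>E. \<gamma> x)) ^ 4) \<partial>\<mu>)"
    by (simp del: of_real_power)
  also have "\<dots> = (\<integral>\<gamma>. (\<Sum>i\<in>?I. 1 * \<gamma> (?d i)) \<partial>\<mu>)"
  proof (rule Bochner_Integration.integral_cong[OF refl])
    fix \<gamma> assume "\<gamma> \<in> space \<mu>"
    then have g: "\<gamma> \<in> dual_group" by simp
    have sq: "of_real ((norm (\<Sum>x\<in>E. \<gamma> x))\<^sup>2) = (\<Sum>(x, y)\<in>E \<times> E. \<gamma> (x - y))"
      unfolding complex_norm_square cnj_sum sum_product sum.cartesian_product
      by (rule sum.cong) (auto simp: dual_group_diff[OF g])
    have "of_real ((norm (\<Sum>x\<in>E. \<gamma> x)) ^ 4)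
        = complex_of_real ((norm (\<Sum>x\<in>E. \<gamma> x))\<^sup>2) * of_real ((norm (\<Sum>x\<in>E. \<gamma> x))\<^sup>2)"
      by (simp flip: of_real_mult power_add)
    also have "\<dots> = (\<Sum>i\<in>?I. 1 * \<gamma> (?d i))"
      unfolding sq sum_product sum.cartesian_product
      by (rule sum.cong) (auto simp: dual_groupD(2)[OF g])
    finally show "of_real ((norm (\<Sum>x\<in>E. \<gamma> x)) ^ 4) = (\<Sum>i\<in>?I. 1 * \<gamma> (?d i))" .
  qed
  also have "\<dots> = (\<Sum>i\<in>?I. if ?d i = 0 then 1 / of_real c else 0)"
    using assms by (intro integral_sum_eval) simp
  also have "\<dots> = of_nat (card {i \<in> ?I. ?d i = 0}) / of_real c"
    using assms by (simp add: sum.inter_filter[symmetric])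
  also have "{i \<in> ?I. ?d i = 0}
      = {((x, y), (z, w)). x \<in> E \<and> y \<in> E \<and> z \<in> E \<and> w \<in> E \<and> x - y + (z - w) = 0}" by auto
  finally show ?thesis
    unfolding energy_def by (metis (no_types, lifting) of_real_divide of_real_eq_iff of_real_of_nat_eq)
qed

end

subsection \<open>Monotonicity of the quasi-norms in the exponent\<close>

lemma Lnorm_eqI:
  assumes "b > 0" "(\<integral>\<^sup>+ x. ennreal (norm (g x) powr (1 / b)) \<partial>M) = ennreal I" "I \<ge> 0"
  shows "Lnorm M b g = ennreal (I powr b)"
  using assms by (simp add: Lnorm_def)

lemma Lnorm_leI:
  assumes "b > 0" "(\<integral>\<^sup>+ x. ennreal (norm (g x) powr (1 / b)) \<partial>M) \<le> ennreal (K powr (1 / b))" "K \<ge> 0"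
  shows "Lnorm M b g \<le> ennreal K"
proof -
  let ?I = "\<integral>\<^sup>+ x. ennreal (norm (g x) powr (1 / b)) \<partial>M"
  have fin: "?I < \<infinity>" using assms(2) by (metis ennreal_less_top infinity_ennreal_def le_less_trans)
  then obtain r where r: "?I = ennreal r" "r \<ge> 0" by (cases ?I) auto
  then have "r \<le> K powr (1 / b)" using assms(2) by (simp add: ennreal_le_iff)
  then have "r powr b \<le> (K powr (1 / b)) powr b" using r assms by (intro powr_mono2) auto
  then have "r powr b \<le> K" using assms by (simp add: powr_powr)
  then show ?thesis using Lnorm_eqI[OF assms(1) r] by (simp add: ennreal_leI)
qed

lemma Lnorm_cong:
  assumes "\<And>x. x \<in> space M \<Longrightarrow> norm (f x) = norm (g x)"
    "f \<in> borel_measurable M" "g \<in> borel_measurable M"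
  shows "Lnorm M b f = Lnorm M b g"
proof -
  have "(\<integral>\<^sup>+ x. ennreal (norm (f x) powr (1 / b)) \<partial>M) = (\<integral>\<^sup>+ x. ennreal (norm (g x) powr (1 / b)) \<partial>M)"
    by (rule nn_integral_cong) (simp add: assms)
  moreover have "esssup M (\<lambda>x. ennreal (norm (f x))) = esssup M (\<lambda>x. ennreal (norm (g x)))"
    by (rule esssup_AE_cong) (use assms in auto)
  ultimately show ?thesis unfolding Lnorm_def by metis
qed

text \<open>Jensen's inequality for the concave power \<rho>, proved by integrating a tangent line.
  The tangent is taken at the mean \<open>l\<close> = I/m, which makes the integrated bound exactly
  m^(1-\<rho>) I^\<rho>; Young's inequality says that the graph lies below this tangent.\<close>

lemma nn_integral_powr_le:
  assumes [measurable]: "u \<in> borel_measurable M" and u: "\<And>x. u x \<ge> 0"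
    and m: "emeasure M (space M) = ennreal m" "m > 0"
    and I: "(\<integral>\<^sup>+ x. ennreal (u x) \<partial>M) = ennreal I" "I \<ge> 0"
    and \<rho>: "0 < \<rho>" "\<rho> \<le> 1"
  shows "(\<integral>\<^sup>+ x. ennreal (u x powr \<rho>) \<partial>M) \<le> ennreal (m powr (1 - \<rho>) * I powr \<rho>)"
proof (cases "I = 0")
  case True
  then have "AE x in M. ennreal (u x) = 0" using I by (simp add: nn_integral_0_iff_AE)
  then have "AE x in M. ennreal (u x powr \<rho>) = 0" by eventually_elim (use u in \<open>simp add: order_antisym\<close>)
  then have "(\<integral>\<^sup>+ x. ennreal (u x powr \<rho>) \<partial>M) = 0" by (simp add: nn_integral_0_iff_AE)
  then show ?thesis by simp
next
  case False
  then have "I > 0" using I by simp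
  define l where "l = I / m"
  have l: "l > 0" using \<open>I > 0\<close> m by (simp add: l_def)
  have young: "u x powr \<rho> \<le> l powr (\<rho> - 1) * (\<rho> * u x + (1 - \<rho>) * l)" for x
  proof (cases "u x = 0")
    case True
    then show ?thesis using \<rho> l by simp
  next
    case False
    then have "u x > 0" using u[of x] by simp
    then have "u x powr \<rho> * l powr (1 - \<rho>) \<le> \<rho> * u x + (1 - \<rho>) * l"
      using \<rho> l by (intro Youngs_inequality_0) auto
    then have "l powr (\<rho> - 1) * (u x powr \<rho> * l powr (1 - \<rho>)) \<le> l powr (\<rho> - 1) * (\<rho> * u x + (1 - \<rho>) * l)"
      by (rule mult_left_mono) simp
    moreover have "l powr (\<rho> - 1) * (u x powr \<rho> * l powr (1 - \<rho>))
        = u x powr \<rho> * (l powr (\<rho> - 1) * l powr (1 - \<rho>))" by simp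
    moreover have "l powr (\<rho> - 1) * l powr (1 - \<rho>) = 1" using l by (simp flip: powr_add)
    ultimately show ?thesis by simp
  qed
  let ?k = "l powr (\<rho> - 1)"
  have "(\<integral>\<^sup>+ x. ennreal (u x powr \<rho>) \<partial>M)
      \<le> (\<integral>\<^sup>+ x. ennreal (?k * \<rho>) * ennreal (u x) + ennreal (?k * (1 - \<rho>) * l) \<partial>M)"
  proof (rule nn_integral_mono)
    fix x
    have "ennreal (u x powr \<rho>) \<le> ennreal (?k * \<rho> * u x + ?k * (1 - \<rho>) * l)"
      using young[of x] by (intro ennreal_leI) (simp add: algebra_simps)
    also have "\<dots> = ennreal (?k * \<rho>) * ennreal (u x) + ennreal (?k * (1 - \<rho>) * l)"
      using u[of x] \<rho> l by (simp add: ennreal_plus ennreal_mult)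
    finally show "ennreal (u x powr \<rho>) \<le> ennreal (?k * \<rho>) * ennreal (u x) + ennreal (?k * (1 - \<rho>) * l)" .
  qed
  also have "\<dots> = ennreal (?k * \<rho>) * ennreal I + ennreal (?k * (1 - \<rho>) * l) * ennreal m"
    by (simp add: nn_integral_add nn_integral_cmult I m)
  also have "\<dots> = ennreal (?k * \<rho> * I + ?k * (1 - \<rho>) * l * m)"
    using \<rho> l I m by (simp add: ennreal_mult[symmetric] ennreal_plus[symmetric] del: ennreal_plus)
  also have "?k * \<rho> * I + ?k * (1 - \<rho>) * l * m = ?k * I"
    using m by (simp add: l_def field_simps)
  also have "?k * I = m powr (1 - \<rho>) * I powr \<rho>"
  proof -
    have "?k = I powr (\<rho> - 1) / m powr (\<rho> - 1)" using \<open>I > 0\<close> m by (simp add: l_def powr_divide)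
    also have "\<dots> = I powr (\<rho> - 1) * m powr (1 - \<rho>)"
      using powr_minus_divide[of m "\<rho> - 1"] by simp
    finally have "?k * I = m powr (1 - \<rho>) * (I powr (\<rho> - 1) * I)" by simp
    moreover have "I powr (\<rho> - 1) * I = I powr \<rho>"
      using \<open>I > 0\<close> powr_add[of I "\<rho> - 1" 1] by simp
    ultimately show ?thesis by simp
  qed
  finally show ?thesis .
qed

text \<open>Hoelder's inequality on a space of total mass \<open>m\<close>: a larger reciprocal
  exponent is a smaller exponent. It applies to quasi-norms too, since only the ratio b/b' <= 1
  enters. For b = 0 the pointwise essential bound is integrated instead.\<close>

lemma Lnorm_mono_exponent:
  assumes [measurable]: "g \<in> borel_measurable M"
    and m: "emeasure M (space M) = ennreal m" "m > 0"
    and b: "0 \<le> b" "b \<le> b'"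
  shows "Lnorm M b' g \<le> ennreal (m powr (b' - b)) * Lnorm M b g"
proof -
  consider "b = b'" | "b < b'" "Lnorm M b g = \<infinity>" | r where "b < b'" "Lnorm M b g = ennreal r" "r \<ge> 0"
    using b by (cases "Lnorm M b g") fastforce+
  then show ?thesis
  proof cases
    case 1
    then show ?thesis using m by simp
  next
    case 2
    then have "ennreal (m powr (b' - b)) * Lnorm M b g = \<infinity>" using m by (simp add: ennreal_mult_top)
    then show ?thesis by simp
  next
    case 3
    have "Lnorm M b' g \<le> ennreal (m powr (b' - b) * r)"
    proof (rule Lnorm_leI)
      show "b' > 0" "0 \<le> m powr (b' - b) * r" using 3 b by auto
      show "(\<integral>\<^sup>+ x. ennreal (norm (g x) powr (1 / b')) \<partial>M) \<le> ennreal ((m powr (b' - b) * r) powr (1 / b'))"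
      proof (cases "b = 0")
        case True
        have "AE x in M. ennreal (norm (g x)) \<le> ennreal r"
          using esssup_AE[of "\<lambda>x. ennreal (norm (g x))" M] 3 True by (simp add: Lnorm_def)
        then have "AE x in M. ennreal (norm (g x) powr (1 / b')) \<le> ennreal (r powr (1 / b'))"
          by eventually_elim (use 3 \<open>b' > 0\<close> in \<open>auto intro!: ennreal_leI powr_mono2\<close>)
        then have "(\<integral>\<^sup>+ x. ennreal (norm (g x) powr (1 / b')) \<partial>M) \<le> (\<integral>\<^sup>+ x. ennreal (r powr (1 / b')) \<partial>M)"
          by (rule nn_integral_mono_AE)
        also have "\<dots> = ennreal (r powr (1 / b') * m)" using m by (simp add: ennreal_mult)
        also have "r powr (1 / b') * m = (m powr (b' - b) * r) powr (1 / b')"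
          using m 3 True \<open>b' > 0\<close> by (simp add: powr_mult powr_powr)
        finally show ?thesis .
      next
        case False
        then have "b > 0" using b by simp
        let ?I = "\<integral>\<^sup>+ x. ennreal (norm (g x) powr (1 / b)) \<partial>M"
        have "?I \<noteq> \<infinity>" using 3 \<open>b > 0\<close> by (auto simp: Lnorm_def Let_def split: if_splits)
        then obtain I where I: "?I = ennreal I" "I \<ge> 0" by (cases ?I) auto
        have r: "r = I powr b" using Lnorm_eqI[OF \<open>b > 0\<close> I] 3 by simp
        have "(\<integral>\<^sup>+ x. ennreal ((norm (g x) powr (1 / b)) powr (b / b')) \<partial>M)
            \<le> ennreal (m powr (1 - b / b') * I powr (b / b'))"
          by (rule nn_integral_powr_le) (use I m b 3 \<open>b > 0\<close> in auto)
        also have "m powr (1 - b / b') * I powr (b / b') = (m powr (b' - b) * r) powr (1 / b')"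
          using \<open>b > 0\<close> \<open>b' > 0\<close> I m by (simp add: r powr_mult powr_powr diff_divide_distrib)
        finally show ?thesis using \<open>b > 0\<close> by (simp add: powr_powr)
      qed
    qed
    also have "\<dots> = ennreal (m powr (b' - b)) * Lnorm M b g" using 3 by (simp add: ennreal_mult)
    finally show ?thesis .
  qed
qed

subsection \<open>Three lines and the Hausdorff--Young inequality\<close>

text \<open>The strip is unbounded, so the maximum principle is applied on a rectangle to f(w)
  exp(\<epsilon>(w^2 - 1)). The extra factor has modulus at most 1 on the strip and decays as |Im w|
  grows, which beats the a priori bound \<open>B\<close> on the horizontal sides; finally \<epsilon>
  tends to 0.\<close>

lemma three_lines:
  fixes f :: "complex \<Rightarrow> complex"
  assumes holo: "f holomorphic_on UNIV"
    and bdd: "\<And>z. 0 \<le> Re z \<Longrightarrow> Re z \<le> 1 \<Longrightarrow> norm (f z) \<le> B"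
    and left: "\<And>z. Re z = 0 \<Longrightarrow> norm (f z) \<le> 1"
    and right: "\<And>z. Re z = 1 \<Longrightarrow> norm (f z) \<le> 1"
    and z: "0 \<le> Re z" "Re z \<le> 1"
  shows "norm (f z) \<le> 1"
proof -
  have key: "norm (f z) * exp (\<epsilon> * Re (z\<^sup>2 - 1)) \<le> 1" if "\<epsilon> > 0" for \<epsilon> :: real
  proof -
    define g where "g w = f w * exp (of_real \<epsilon> * (w\<^sup>2 - 1))" for w
    define C where "C = max B 1"
    \<comment> \<open>The height makes \<epsilon> R^2 >= ln C, so the Gaussian factor is at most 1/C
      on the horizontal sides, and it is large enough for the rectangle to contain
      \<open>z\<close>.\<close>
    define R where "R = max \<bar>Im z\<bar> (sqrt (ln C / \<epsilon>))"
    have C: "C \<ge> 1" "ln C \<ge> 0" by (auto simp: C_def)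
    have R: "R \<ge> 0" by (auto simp: R_def)
    have "ln C / \<epsilon> = (sqrt (ln C / \<epsilon>))\<^sup>2" using C that by simp
    also have "\<dots> \<le> R\<^sup>2" using C that by (intro power_mono) (auto simp: R_def)
    finally have R2: "ln C \<le> \<epsilon> * R\<^sup>2" using that by (simp add: field_simps)
    have norm_g: "norm (g w) = norm (f w) * exp (\<epsilon> * ((Re w)\<^sup>2 - (Im w)\<^sup>2 - 1))" for w
      by (simp add: g_def norm_mult power2_eq_square)
    let ?S = "cbox (Complex 0 (- R)) (Complex 1 R)"
    have "g holomorphic_on A" for A
      unfolding g_def by (intro holomorphic_intros holomorphic_on_subset[OF holo]) auto
    moreover have "norm (g w) \<le> 1" if w_fr: "w \<in> frontier ?S" for w
    proof -
      have w: "0 \<le> Re w" "Re w \<le> 1"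
        using w_fr by (auto simp: frontier_cbox in_cbox_complex_iff)
      have sq: "(Re w)\<^sup>2 \<le> 1" using w by (simp add: power_le_one)
      consider "Re w = 0 \<or> Re w = 1" | "\<bar>Im w\<bar> = R"
        using w_fr by (fastforce simp: frontier_cbox in_cbox_complex_iff in_box_complex_iff)
      then show ?thesis
      proof cases
        case 1
        then have f1: "norm (f w) \<le> 1" using left right by auto
        have "\<epsilon> * ((Re w)\<^sup>2 - (Im w)\<^sup>2 - 1) \<le> 0"
          using sq \<open>\<epsilon> > 0\<close> by (intro mult_nonneg_nonpos) (auto simp: add_nonneg_nonneg algebra_simps intro: order_trans)
        then show ?thesis unfolding norm_g using f1 by (intro mult_le_one) auto
      next
        case 2
        then have "(Im w)\<^sup>2 = R\<^sup>2" by (metis power2_abs)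
        then have "\<epsilon> * ((Re w)\<^sup>2 - (Im w)\<^sup>2 - 1) \<le> \<epsilon> * (- R\<^sup>2)"
          using sq \<open>\<epsilon> > 0\<close> by (intro mult_left_mono) auto
        also have "\<dots> \<le> - ln C" using R2 by simp
        finally have "exp (\<epsilon> * ((Re w)\<^sup>2 - (Im w)\<^sup>2 - 1)) \<le> exp (- ln C)" by simp
        also have "\<dots> = 1 / C" using C by (simp add: exp_minus inverse_eq_divide)
        finally have e: "exp (\<epsilon> * ((Re w)\<^sup>2 - (Im w)\<^sup>2 - 1)) \<le> 1 / C" .
        have "norm (f w) \<le> C" using bdd[OF w] by (simp add: C_def)
        then have "norm (g w) \<le> C * (1 / C)"
          unfolding norm_g using e C by (intro mult_mono) auto
        then show ?thesis using C by simp
      qed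
    qed
    moreover have "z \<in> ?S" using z by (auto simp: in_cbox_complex_iff R_def)
    ultimately have "norm (g z) \<le> 1"
      by (intro maximum_modulus_frontier[of g ?S 1 z] holomorphic_on_imp_continuous_on bounded_cbox)
    then show ?thesis by (simp add: norm_g power2_eq_square)
  qed
  have "((\<lambda>\<epsilon>. norm (f z) * exp (\<epsilon> * Re (z\<^sup>2 - 1))) \<longlongrightarrow> norm (f z) * exp (0 * Re (z\<^sup>2 - 1))) (at_right 0)"
    by (intro tendsto_intros)
  moreover have "\<forall>\<^sub>F \<epsilon> in at_right 0. norm (f z) * exp (\<epsilon> * Re (z\<^sup>2 - 1)) \<le> 1"
    using key by (intro eventually_at_rightI[of 0 1]) auto
  ultimately have "norm (f z) * exp (0 * Re (z\<^sup>2 - 1)) \<le> 1"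
    by (rule tendsto_upperbound) simp
  then show ?thesis by simp
qed

text \<open>The analytic family through \<open>v\<close>: it equals \<open>v\<close> at \<open>z = 2a - 1\<close>, has modulus
  \<open>\<bar>v\<bar>\<^bsup>1/2a\<^esup>\<close> on the line \<open>Re z = 0\<close> and \<open>\<bar>v\<bar>\<^bsup>1/a\<^esup>\<close> on the line \<open>Re z = 1\<close>.\<close>

definition stein :: "real \<Rightarrow> complex \<Rightarrow> complex \<Rightarrow> complex" where
  "stein a v z = of_real (norm v) powr ((1 + z) / of_real (2 * a)) * sgn v"

lemma norm_stein:
  "norm (stein a v z) = norm v powr ((1 + Re z) / (2 * a))"
proof (cases "v = 0")
  case False
  have "Re ((1 + z) / of_real (2 * a)) = (1 + Re z) / (2 * a)"
    by (subst Re_divide_of_real) simp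
  then show ?thesis using False
    by (simp add: stein_def norm_mult norm_sgn norm_powr_real_powr)
qed (simp add: stein_def)

lemma stein_base: "a > 0 \<Longrightarrow> stein a v (of_real (2 * a - 1)) = v"
proof (cases "v = 0")
  case False
  assume "a > 0"
  then have "(1 + of_real (2 * a - 1)) / of_real (2 * a) = (1::complex)" by simp
  then show ?thesis using False by (simp add: stein_def sgn_eq)
qed (simp add: stein_def)

text \<open>Adding 1 to the modulus makes the base at least 1, so the power is monotone in the
  exponent and one bound serves the whole strip.\<close>

lemma stein_le:
  assumes "a > 0" "0 \<le> Re z" "Re z \<le> 1"
  shows "norm (stein a v z) \<le> (1 + norm v) powr (1 / a)"
proof -
  have "norm (stein a v z) \<le> (1 + norm v) powr ((1 + Re z) / (2 * a))"
    unfolding norm_stein using assms by (intro powr_mono2) auto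
  also have "\<dots> \<le> (1 + norm v) powr (1 / a)"
    using assms by (intro powr_mono) (auto simp: field_simps)
  finally show ?thesis .
qed

lemma holomorphic_stein [holomorphic_intros]: "stein a v holomorphic_on S"
proof -
  have "(\<lambda>z. of_real (norm v) powr ((1 + z) * (1 / of_real (2 * a))) * sgn v) holomorphic_on S"
    by (intro holomorphic_intros)
  then show ?thesis by (simp add: stein_def[abs_def])
qed

section \<open>Interpolation of the Fourier pairing\<close>

context dual_haar
begin

lemma integrable_transform_simple:
  fixes k :: "complex \<Rightarrow> 'b::{banach, second_countable_topology}"
  assumes h: "simple_function \<mu> h"
  shows "integrable \<mu> (\<lambda>\<gamma>. k (h \<gamma>))"
    and "integrable \<mu> (\<lambda>\<gamma>. transform E f \<gamma> * l (h \<gamma>))"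
proof -
  have bound: "\<exists>B. \<forall>\<gamma>\<in>dual_group. norm (k' (h \<gamma>)) \<le> B" for k' :: "complex \<Rightarrow> 'c::real_normed_vector"
  proof -
    have "finite ((\<lambda>v. k' v) ` h ` space \<mu>)" using simple_functionD(1)[OF h] by simp
    then have "bounded ((\<lambda>v. k' v) ` h ` space \<mu>)" by (rule finite_imp_bounded)
    then show ?thesis unfolding bounded_iff by auto
  qed
  have meas [measurable]: "(\<lambda>\<gamma>. k (h \<gamma>)) \<in> borel_measurable \<mu>"
    "(\<lambda>\<gamma>. l (h \<gamma>)) \<in> borel_measurable \<mu>"
    using h by (auto intro: borel_measurable_simple_function simple_function_compose1)
  obtain B where "\<And>\<gamma>. \<gamma> \<in> dual_group \<Longrightarrow> norm (k (h \<gamma>)) \<le> B" using bound by blast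
  then show "integrable \<mu> (\<lambda>\<gamma>. k (h \<gamma>))" by (intro integrable_bounded_haar) auto
  obtain B where B: "\<And>\<gamma>. \<gamma> \<in> dual_group \<Longrightarrow> norm (l (h \<gamma>)) \<le> B" using bound by blast
  show "integrable \<mu> (\<lambda>\<gamma>. transform E f \<gamma> * l (h \<gamma>))"
  proof (rule integrable_bounded_haar)
    fix \<gamma> :: "'a \<Rightarrow> complex" assume g: "\<gamma> \<in> dual_group"
    show "norm (transform E f \<gamma> * l (h \<gamma>)) \<le> (c * (\<Sum>x\<in>E. norm (f x))) * B"
      unfolding norm_mult
      by (intro mult_mono norm_transform_le B g) (auto intro!: mult_nonneg_nonneg sum_nonneg less_imp_le[OF c_pos])
  qed measurable
qed

text \<open>Both \<open>f\<close> and \<open>h\<close> move in analytic families with the same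
  exponent 1/a, because 1/a is also conjugate to the target exponent 1/(1-a). On Re z = 0 the
  pairing is controlled by Parseval, on Re z = 1 by the sup bound of the transform, and z = 2a - 1
  returns the original pairing.\<close>

lemma riesz_thorin_normalized:
  assumes E: "finite E" and a: "1 / 2 \<le> a" "a \<le> 1"
    and h: "simple_function \<mu> h"
    and fn: "c * (\<Sum>x\<in>E. norm (f x) powr (1 / a)) = 1"
    and hn: "(\<integral>\<gamma>. norm (h \<gamma>) powr (1 / a) \<partial>\<mu>) = 1"
  shows "norm (\<integral>\<gamma>. transform E f \<gamma> * h \<gamma> \<partial>\<mu>) \<le> 1"
proof -
  have "a > 0" using a by simp
  define F where "F z = (\<integral>\<gamma>. transform E (\<lambda>x. stein a (f x) z) \<gamma> * stein a (h \<gamma>) z \<partial>\<mu>)" for z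
  define V where "V = h ` dual_group"
  define K where "K x v = (\<integral>\<gamma>. cnj (\<gamma> x) * indicator (h -` {v} \<inter> space \<mu>) \<gamma> \<partial>\<mu>)" for x v
  have V: "finite V" using simple_functionD(1)[OF h] by (simp add: V_def)
  have cnjm [measurable]: "cnj \<in> borel_measurable borel"
    by (intro borel_measurable_continuous_onI continuous_intros)
  have [measurable]: "h -` {v} \<inter> space \<mu> \<in> sets \<mu>" for v
    using simple_functionD(2)[OF h] by blast
  \<comment> \<open>Since \<open>h\<close> has finitely many values, \<open>F\<close> is a finite
    combination of entire functions with coefficients \<open>K x v\<close>; holomorphy and
    boundedness on the strip are read off from this form.\<close>
  have F_sum: "F z = (\<Sum>x\<in>E. \<Sum>v\<in>V. of_real c * stein a (f x) z * stein a v z * K x v)" for z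
  proof -
    have int: "integrable \<mu> (\<lambda>\<gamma>. cnj (\<gamma> x) * indicator (h -` {v} \<inter> space \<mu>) \<gamma>)" for x v
    proof (rule integrable_bounded_haar[where B = 1])
      fix \<gamma> :: "'a \<Rightarrow> complex" assume "\<gamma> \<in> dual_group"
      then show "norm (cnj (\<gamma> x) * indicator (h -` {v} \<inter> space \<mu>) \<gamma>) \<le> 1"
        by (auto simp: norm_mult dual_groupD indicator_def)
    qed measurable
    have inner: "(\<integral>\<gamma>. (\<Sum>v\<in>V. of_real c * stein a (f x) z * stein a v z
        * (cnj (\<gamma> x) * indicator (h -` {v} \<inter> space \<mu>) \<gamma>)) \<partial>\<mu>)
      = (\<Sum>v\<in>V. of_real c * stein a (f x) z * stein a v z * K x v)" for x
      unfolding K_def integral_mult_right_zero[symmetric]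
      by (rule Bochner_Integration.integral_sum) (intro integrable_mult_right int)
    have "F z = (\<integral>\<gamma>. (\<Sum>x\<in>E. \<Sum>v\<in>V. of_real c * stein a (f x) z * stein a v z
        * (cnj (\<gamma> x) * indicator (h -` {v} \<inter> space \<mu>) \<gamma>)) \<partial>\<mu>)"
      unfolding F_def
    proof (rule Bochner_Integration.integral_cong[OF refl])
      fix \<gamma> assume g: "\<gamma> \<in> space \<mu>"
      have "(\<Sum>v\<in>V. k * stein a v z * (k' * indicator (h -` {v} \<inter> space \<mu>) \<gamma>)) = k * k' * stein a (h \<gamma>) z"
        for k k'
      proof -
        have "(\<Sum>v\<in>V. k * stein a v z * (k' * indicator (h -` {v} \<inter> space \<mu>) \<gamma>))
            = (\<Sum>v\<in>V. if v = h \<gamma> then k * k' * stein a v z else 0)"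
          using g by (intro sum.cong) (auto simp: indicator_def)
        also have "\<dots> = k * k' * stein a (h \<gamma>) z"
          using g V by (simp add: V_def)
        finally show ?thesis .
      qed
      then show "transform E (\<lambda>x. stein a (f x) z) \<gamma> * stein a (h \<gamma>) z
          = (\<Sum>x\<in>E. \<Sum>v\<in>V. of_real c * stein a (f x) z * stein a v z
              * (cnj (\<gamma> x) * indicator (h -` {v} \<inter> space \<mu>) \<gamma>))"
        by (simp add: transform_def sum_distrib_right)
    qed
    also have "\<dots> = (\<Sum>x\<in>E. \<Sum>v\<in>V. of_real c * stein a (f x) z * stein a v z * K x v)"
      unfolding inner[symmetric]
      by (rule Bochner_Integration.integral_sum)
         (intro Bochner_Integration.integrable_sum integrable_mult_right int)
    finally show ?thesis .
  qed
  have int: "integrable \<mu> (\<lambda>\<gamma>. norm (h \<gamma>) powr (1 / a))"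
    by (rule integrable_transform_simple(1)[OF h])
  have "norm (F (of_real (2 * a - 1))) \<le> 1"
  proof (rule three_lines[where f = F])
    show "F holomorphic_on UNIV"
      unfolding F_sum[abs_def] by (intro holomorphic_intros)
  next
    fix z :: complex assume z: "0 \<le> Re z" "Re z \<le> 1"
    show "norm (F z) \<le> (\<Sum>x\<in>E. \<Sum>v\<in>V. c * (1 + norm (f x)) powr (1 / a) * (1 + norm v) powr (1 / a) * norm (K x v))"
      unfolding F_sum
      by (intro sum_norm_le)
         (auto simp: norm_mult intro!: mult_mono mult_nonneg_nonneg stein_le z \<open>a > 0\<close> c_pos less_imp_le[OF c_pos])
  next
    fix z :: complex assume z: "Re z = 0"
    have sq: "(norm (stein a v z))\<^sup>2 = norm v powr (1 / a)" for v
    proof -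
      have "1 / (2 * a) + 1 / (2 * a) = 1 / a" using \<open>a > 0\<close> by (simp add: field_simps)
      then show ?thesis by (simp add: norm_stein z power2_eq_square flip: powr_add)
    qed
    let ?T = "transform E (\<lambda>x. stein a (f x) z)"
    have "norm (F z) \<le> (\<integral>\<gamma>. norm (?T \<gamma> * stein a (h \<gamma>) z) \<partial>\<mu>)"
      unfolding F_def by (rule integral_norm_bound)
    \<comment> \<open>Both squares integrate to 1 by the normalization, so the arithmetic-geometric
      mean inequality gives the same bound as Cauchy-Schwarz.\<close>
    also have "\<dots> \<le> (\<integral>\<gamma>. (1/2) * (norm (?T \<gamma>))\<^sup>2 + (1/2) * norm (h \<gamma>) powr (1 / a) \<partial>\<mu>)"
    proof (rule integral_mono)
      show "integrable \<mu> (\<lambda>\<gamma>. norm (?T \<gamma> * stein a (h \<gamma>) z))"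
        by (intro integrable_norm integrable_transform_simple[OF h])
      have "integrable \<mu> (\<lambda>\<gamma>. (norm (?T \<gamma>))\<^sup>2)"
        by (rule integrable_bounded_haar[where B = "(c * (\<Sum>x\<in>E. norm (stein a (f x) z)))\<^sup>2"])
           (auto intro!: power_mono norm_transform_le)
      then show "integrable \<mu> (\<lambda>\<gamma>. (1/2) * (norm (?T \<gamma>))\<^sup>2 + (1/2) * norm (h \<gamma>) powr (1 / a))"
        using int by simp
    next
      fix \<gamma> assume "\<gamma> \<in> space \<mu>"
      have "2 * (norm (?T \<gamma>) * norm (stein a (h \<gamma>) z)) \<le> (norm (?T \<gamma>))\<^sup>2 + (norm (stein a (h \<gamma>) z))\<^sup>2"
        using sum_squares_bound[of "norm (?T \<gamma>)"] by (simp add: mult.assoc)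
      then show "norm (?T \<gamma> * stein a (h \<gamma>) z) \<le> (1/2) * (norm (?T \<gamma>))\<^sup>2 + (1/2) * norm (h \<gamma>) powr (1 / a)"
        by (simp add: norm_mult sq)
    qed
    also have "\<dots> = (1/2) * (\<integral>\<gamma>. (norm (?T \<gamma>))\<^sup>2 \<partial>\<mu>) + (1/2) * (\<integral>\<gamma>. norm (h \<gamma>) powr (1 / a) \<partial>\<mu>)"
    proof -
      have "integrable \<mu> (\<lambda>\<gamma>. (norm (?T \<gamma>))\<^sup>2)"
        by (rule integrable_bounded_haar[where B = "(c * (\<Sum>x\<in>E. norm (stein a (f x) z)))\<^sup>2"])
           (auto intro!: power_mono norm_transform_le)
      then show ?thesis using int by simp
    qed
    also have "\<dots> = 1"
      using fn by (simp add: parseval[OF E] sq hn)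
    finally show "norm (F z) \<le> 1" .
  next
    fix z :: complex assume z: "Re z = 1"
    have eq: "norm (stein a v z) = norm v powr (1 / a)" for v
      by (simp add: norm_stein z)
    let ?T = "transform E (\<lambda>x. stein a (f x) z)"
    have "norm (F z) \<le> (\<integral>\<gamma>. norm (?T \<gamma> * stein a (h \<gamma>) z) \<partial>\<mu>)"
      unfolding F_def by (rule integral_norm_bound)
    also have "\<dots> \<le> (\<integral>\<gamma>. norm (h \<gamma>) powr (1 / a) \<partial>\<mu>)"
    proof (rule integral_mono[OF _ int])
      show "integrable \<mu> (\<lambda>\<gamma>. norm (?T \<gamma> * stein a (h \<gamma>) z))"
        by (intro integrable_norm integrable_transform_simple[OF h])
    next
      fix \<gamma> assume "\<gamma> \<in> space \<mu>"
      then have "norm (?T \<gamma>) \<le> 1"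
        using norm_transform_le[of \<gamma> E "\<lambda>x. stein a (f x) z"] fn by (simp add: eq)
      then show "norm (?T \<gamma> * stein a (h \<gamma>) z) \<le> norm (h \<gamma>) powr (1 / a)"
        unfolding norm_mult eq using mult_right_mono[of "norm (?T \<gamma>)" 1] by fastforce
    qed
    finally show "norm (F z) \<le> 1" using hn by simp
  qed (use a in auto)
  then show ?thesis by (simp only: F_def stein_base[OF \<open>a > 0\<close>])
qed

lemma transform_cmult: "transform E (\<lambda>x. k * f x) \<gamma> = k * transform E f \<gamma>"
  by (simp add: transform_def sum_distrib_left mult_ac)

text \<open>Both sides are homogeneous in \<open>f\<close> and in \<open>h\<close>, so dividing by
  the two norms reduces to the normalized case. If one norm vanishes, so does the pairing.\<close>

lemma riesz_thorin_simple:
  assumes E: "finite E" and a: "1 / 2 \<le> a" "a \<le> 1"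
    and h: "simple_function \<mu> h"
  shows "norm (\<integral>\<gamma>. transform E f \<gamma> * h \<gamma> \<partial>\<mu>)
    \<le> (c * (\<Sum>x\<in>E. norm (f x) powr (1 / a))) powr a * (\<integral>\<gamma>. norm (h \<gamma>) powr (1 / a) \<partial>\<mu>) powr a"
    (is "?L \<le> ?A powr a * ?B powr a")
proof -
  have "a > 0" using a by simp
  have A0: "?A \<ge> 0" using c_pos by (auto intro!: mult_nonneg_nonneg sum_nonneg)
  have B0: "?B \<ge> 0" by (rule integral_nonneg_AE) simp
  have int: "integrable \<mu> (\<lambda>\<gamma>. norm (h \<gamma>) powr (1 / a))"
    by (rule integrable_transform_simple(1)[OF h])
  consider "?A = 0" | "?B = 0" | "?A > 0" "?B > 0" using A0 B0 by linarith
  then show ?thesis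
  proof cases
    case 1
    then have "(\<Sum>x\<in>E. norm (f x) powr (1 / a)) = 0" using c_pos by simp
    then have "\<forall>x\<in>E. f x = 0" using E by (simp add: sum_nonneg_eq_0_iff)
    then have "transform E f \<gamma> = 0" for \<gamma> by (simp add: transform_def)
    then show ?thesis by simp
  next
    case 2
    then have "AE \<gamma> in \<mu>. norm (h \<gamma>) powr (1 / a) = 0"
      using integral_nonneg_eq_0_iff_AE[OF int] by simp
    then have "AE \<gamma> in \<mu>. transform E f \<gamma> * h \<gamma> = 0" by eventually_elim simp
    then have "(\<integral>\<gamma>. transform E f \<gamma> * h \<gamma> \<partial>\<mu>) = 0" by (rule integral_eq_zero_AE)
    then show ?thesis by simp
  next
    case 3
    let ?k = "of_real (1 / ?A powr a) :: complex" and ?l = "of_real (1 / ?B powr a) :: complex"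
    have k: "norm (?k * v) powr (1 / a) = norm v powr (1 / a) / ?A" for v
      using 3 \<open>a > 0\<close> by (simp add: norm_mult norm_divide powr_divide powr_powr)
    have l: "norm (?l * v) powr (1 / a) = norm v powr (1 / a) / ?B" for v
      using 3 \<open>a > 0\<close> by (simp add: norm_mult norm_divide powr_divide powr_powr)
    have "norm (\<integral>\<gamma>. transform E (\<lambda>x. ?k * f x) \<gamma> * (?l * h \<gamma>) \<partial>\<mu>) \<le> 1"
    proof (rule riesz_thorin_normalized[OF E a])
      show "simple_function \<mu> (\<lambda>\<gamma>. ?l * h \<gamma>)"
        using h by (rule simple_function_compose1)
      have "c * (\<Sum>x\<in>E. norm (?k * f x) powr (1 / a)) = ?A / ?A"
        unfolding k by (simp only: sum_divide_distrib[symmetric] times_divide_eq_right)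
      then show "c * (\<Sum>x\<in>E. norm (?k * f x) powr (1 / a)) = 1"
        using divide_self[OF less_imp_neq[OF 3(1), symmetric]] by (rule trans)
      have "(\<integral>\<gamma>. norm (?l * h \<gamma>) powr (1 / a) \<partial>\<mu>) = ?B / ?B"
        unfolding l by simp
      then show "(\<integral>\<gamma>. norm (?l * h \<gamma>) powr (1 / a) \<partial>\<mu>) = 1" using 3 by simp
    qed
    also have "(\<integral>\<gamma>. transform E (\<lambda>x. ?k * f x) \<gamma> * (?l * h \<gamma>) \<partial>\<mu>)
        = (?k * ?l) * (\<integral>\<gamma>. transform E f \<gamma> * h \<gamma> \<partial>\<mu>)"
      unfolding transform_cmult by (subst integral_mult_right_zero[symmetric]) (simp add: mult_ac)
    finally have "?L / (?A powr a * ?B powr a) \<le> 1" by (simp add: norm_mult norm_divide)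
    moreover have "?A powr a * ?B powr a > 0"
      using less_imp_neq[OF 3(1)] less_imp_neq[OF 3(2)]
      by (intro mult_pos_pos powr_gt_zero[THEN iffD2]) (rule not_sym, assumption)+
    ultimately show ?thesis by (simp only: pos_divide_le_eq mult_1_left)
  qed
qed

text \<open>Duality with the extremal function \<open>h\<close>: the pairing with it is the integral
  Q of |S|^q, and since (q - 1)/a = q its own 1/a-th power also integrates to Q. Hence Q <= A^a Q^a,
  and Q is finite because S is bounded, so Q^a can be divided out.\<close>

lemma hausdorff_young_finite:
  assumes E: "finite E" and a: "1 / 2 \<le> a" "a < 1"
  shows "(\<integral>\<gamma>. norm (transform E f \<gamma>) powr (1 / (1 - a)) \<partial>\<mu>)
    \<le> ((c * (\<Sum>x\<in>E. norm (f x) powr (1 / a))) powr a) powr (1 / (1 - a))"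
    (is "?Q \<le> (?A powr a) powr ?q")
proof -
  let ?S = "transform E f"
  have "a > 0" and "?q > 1" using a by (auto simp: field_simps)
  have Q0: "?Q \<ge> 0" by (rule integral_nonneg_AE) simp
  define C where "C = c * (\<Sum>x\<in>E. norm (f x))"
  have C: "norm (?S \<gamma>) \<le> C" if "\<gamma> \<in> dual_group" for \<gamma>
    using norm_transform_le[OF that] by (simp add: C_def)
  have C0: "C \<ge> 0" using c_pos by (auto simp: C_def intro!: mult_nonneg_nonneg sum_nonneg)
  define h where "h \<gamma> = of_real (norm (?S \<gamma>) powr (?q - 1)) * cnj (sgn (?S \<gamma>))" for \<gamma>
  have cnjm [measurable]: "cnj \<in> borel_measurable borel"
    by (intro borel_measurable_continuous_onI continuous_intros)
  have hm [measurable]: "h \<in> borel_measurable \<mu>"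
    unfolding h_def[abs_def] sgn_eq by measurable
  have norm_h: "norm (h \<gamma>) = norm (?S \<gamma>) powr (?q - 1)" for \<gamma>
    by (cases "?S \<gamma> = 0") (auto simp: h_def norm_mult norm_sgn)
  have Sh: "?S \<gamma> * h \<gamma> = of_real (norm (?S \<gamma>) powr ?q)" for \<gamma>
  proof (cases "?S \<gamma> = 0")
    case False
    have "?S \<gamma> * cnj (sgn (?S \<gamma>)) = of_real (norm (?S \<gamma>))"
      using False complex_norm_square[of "?S \<gamma>"] by (simp add: sgn_eq power2_eq_square field_simps)
    then have "?S \<gamma> * h \<gamma> = of_real (norm (?S \<gamma>) * norm (?S \<gamma>) powr (?q - 1))"
      by (simp add: h_def mult_ac)
    also have "norm (?S \<gamma>) * norm (?S \<gamma>) powr (?q - 1) = norm (?S \<gamma>) powr ?q"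
      using False powr_add[of "norm (?S \<gamma>)" 1 "?q - 1"] by simp
    finally show ?thesis .
  qed simp
  have "(?q - 1) * (1 / a) = ?q" using a \<open>a > 0\<close> by (simp add: field_simps)
  then have ha: "norm (h \<gamma>) powr (1 / a) = norm (?S \<gamma>) powr ?q" for \<gamma>
    by (simp only: norm_h powr_powr)
  define D where "D = C powr (?q - 1)"
  have D: "norm (h \<gamma>) \<le> D" if "\<gamma> \<in> dual_group" for \<gamma>
    unfolding norm_h D_def using C[OF that] \<open>?q > 1\<close> by (intro powr_mono2) auto
  have D0: "D \<ge> 0" by (simp add: D_def)
  \<comment> \<open>The pairing bound is available for simple functions only. These approximants are
    dominated by twice |h|, and S and \<open>h\<close> are bounded on a finite measure space, so
    both integrals converge with constant majorants.\<close>
  obtain H where "\<forall>i. simple_function \<mu> (H i)"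
    "\<forall>\<gamma>\<in>space \<mu>. (\<lambda>i. H i \<gamma>) \<longlonglongrightarrow> h \<gamma>"
    "\<forall>i. \<forall>\<gamma>\<in>space \<mu>. dist (H i \<gamma>) 0 \<le> 2 * dist (h \<gamma>) 0"
    using borel_measurable_implies_sequence_metric[OF hm, of 0] by blast
  then have H: "\<And>i. simple_function \<mu> (H i)"
    "\<And>\<gamma>. \<gamma> \<in> space \<mu> \<Longrightarrow> (\<lambda>i. H i \<gamma>) \<longlonglongrightarrow> h \<gamma>"
    "\<And>i \<gamma>. \<gamma> \<in> space \<mu> \<Longrightarrow> norm (H i \<gamma>) \<le> 2 * norm (h \<gamma>)"
    by (auto simp: dist_norm)
  have HD: "norm (H i \<gamma>) \<le> 2 * D" if "\<gamma> \<in> dual_group" for i \<gamma>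
    using H(3)[of \<gamma> i] D[OF that] that by simp
  have Hm [measurable]: "H i \<in> borel_measurable \<mu>" for i
    by (rule borel_measurable_simple_function[OF H(1)])
  have lim1: "(\<lambda>i. \<integral>\<gamma>. ?S \<gamma> * H i \<gamma> \<partial>\<mu>) \<longlonglongrightarrow> (\<integral>\<gamma>. ?S \<gamma> * h \<gamma> \<partial>\<mu>)"
  proof (rule integral_dominated_convergence[where w = "\<lambda>_. C * (2 * D)"])
    show "AE \<gamma> in \<mu>. (\<lambda>i. ?S \<gamma> * H i \<gamma>) \<longlonglongrightarrow> ?S \<gamma> * h \<gamma>"
      by (rule AE_I2) (intro tendsto_intros H)
    show "AE \<gamma> in \<mu>. norm (?S \<gamma> * H i \<gamma>) \<le> C * (2 * D)" for i
      by (rule AE_I2) (auto simp: norm_mult C0 D0 intro!: mult_mono C HD)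
  qed auto
  have lim2: "(\<lambda>i. \<integral>\<gamma>. norm (H i \<gamma>) powr (1 / a) \<partial>\<mu>) \<longlonglongrightarrow> (\<integral>\<gamma>. norm (h \<gamma>) powr (1 / a) \<partial>\<mu>)"
  proof (rule integral_dominated_convergence[where w = "\<lambda>_. (2 * D) powr (1 / a)"])
    show "AE \<gamma> in \<mu>. (\<lambda>i. norm (H i \<gamma>) powr (1 / a)) \<longlonglongrightarrow> norm (h \<gamma>) powr (1 / a)"
      by (rule AE_I2) (intro tendsto_powr2 tendsto_norm tendsto_const H, use \<open>a > 0\<close> in auto)
    show "AE \<gamma> in \<mu>. norm (norm (H i \<gamma>) powr (1 / a)) \<le> (2 * D) powr (1 / a)" for i
      by (rule AE_I2) (use \<open>a > 0\<close> HD in \<open>auto intro!: powr_mono2\<close>)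
  qed auto
  have "norm (\<integral>\<gamma>. ?S \<gamma> * h \<gamma> \<partial>\<mu>) \<le> ?A powr a * (\<integral>\<gamma>. norm (h \<gamma>) powr (1 / a) \<partial>\<mu>) powr a"
  proof (rule LIMSEQ_le)
    show "(\<lambda>i. norm (\<integral>\<gamma>. ?S \<gamma> * H i \<gamma> \<partial>\<mu>)) \<longlonglongrightarrow> norm (\<integral>\<gamma>. ?S \<gamma> * h \<gamma> \<partial>\<mu>)"
      by (intro tendsto_norm lim1)
    show "(\<lambda>i. ?A powr a * (\<integral>\<gamma>. norm (H i \<gamma>) powr (1 / a) \<partial>\<mu>) powr a)
        \<longlonglongrightarrow> ?A powr a * (\<integral>\<gamma>. norm (h \<gamma>) powr (1 / a) \<partial>\<mu>) powr a"
      by (intro tendsto_mult tendsto_powr2 tendsto_const lim2)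
         (use \<open>a > 0\<close> in \<open>auto intro!: always_eventually integral_nonneg_AE\<close>)
    show "\<exists>N. \<forall>i\<ge>N. norm (\<integral>\<gamma>. ?S \<gamma> * H i \<gamma> \<partial>\<mu>)
        \<le> ?A powr a * (\<integral>\<gamma>. norm (H i \<gamma>) powr (1 / a) \<partial>\<mu>) powr a"
      using riesz_thorin_simple[OF E a(1) less_imp_le[OF a(2)] H(1)] by blast
  qed
  also have "(\<integral>\<gamma>. ?S \<gamma> * h \<gamma> \<partial>\<mu>) = of_real ?Q" unfolding Sh by (rule integral_complex_of_real)
  finally have Q: "?Q \<le> ?A powr a * ?Q powr a" using Q0 by (simp add: ha)
  show ?thesis
  proof (cases "?Q = 0")
    case False
    then have "?Q > 0" using Q0 by linarith
    have "?Q powr (1 - a) = ?Q / ?Q powr a" using \<open>?Q > 0\<close> by (simp add: powr_diff)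
    also have "\<dots> \<le> ?A powr a" using Q \<open>?Q > 0\<close> by (simp add: field_simps)
    finally have "(?Q powr (1 - a)) powr ?q \<le> (?A powr a) powr ?q"
      using a by (intro powr_mono2) auto
    then show ?thesis using \<open>?Q > 0\<close> a by (simp add: powr_powr)
  qed simp
qed

end

subsection \<open>The finite region\<close>

lemma Lnorm_leD:
  assumes "b > 0" "Lnorm M b g \<le> ennreal K" "K \<ge> 0"
  shows "(\<integral>\<^sup>+ x. ennreal (norm (g x) powr (1 / b)) \<partial>M) \<le> ennreal (K powr (1 / b))"
proof -
  let ?I = "\<integral>\<^sup>+ x. ennreal (norm (g x) powr (1 / b)) \<partial>M"
  have "?I \<noteq> \<infinity>" using assms by (auto simp: Lnorm_def Let_def top_unique split: if_splits)
  then obtain r where r: "?I = ennreal r" "r \<ge> 0" by (cases ?I) auto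
  then have "r powr b \<le> K" using Lnorm_eqI[OF assms(1) r] assms by (simp add: ennreal_le_iff)
  then have "(r powr b) powr (1 / b) \<le> K powr (1 / b)" using assms by (intro powr_mono2) auto
  then show ?thesis using r assms by (simp add: powr_powr ennreal_leI)
qed

lemma Lnorm_geI:
  assumes "b > 0" "ennreal (K powr (1 / b)) \<le> (\<integral>\<^sup>+ x. ennreal (norm (g x) powr (1 / b)) \<partial>M)" "K \<ge> 0"
  shows "ennreal K \<le> Lnorm M b g"
proof (cases "Lnorm M b g")
  case (real r)
  then have "(\<integral>\<^sup>+ x. ennreal (norm (g x) powr (1 / b)) \<partial>M) \<le> ennreal (r powr (1 / b))"
    using assms by (intro Lnorm_leD) auto
  then have "ennreal (K powr (1 / b)) \<le> ennreal (r powr (1 / b))" using assms(2) by (rule order_trans[rotated])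
  then have "K powr (1 / b) \<le> r powr (1 / b)" by simp
  then have "(K powr (1 / b)) powr b \<le> (r powr (1 / b)) powr b"
    by (rule powr_mono2[OF less_imp_le[OF assms(1)] powr_ge_zero])
  then have "K powr (1 / b * b) \<le> r powr (1 / b * b)" by (simp only: powr_powr)
  then have "K \<le> r" using real assms by simp
  then show ?thesis using real by (simp add: ennreal_leI)
qed simp

text \<open>Each term is at most the total T, so u^a = u u^(a-1) <= u T^(a-1). Applied to |f|^(1/a)
  this is the inclusion into l^1 for a >= 1.\<close>

lemma sum_powr_le_powr_sum:
  fixes u :: "'i \<Rightarrow> real"
  assumes "finite E" "\<And>x. x \<in> E \<Longrightarrow> u x \<ge> 0" "a \<ge> 1"
  shows "(\<Sum>x\<in>E. u x powr a) \<le> (\<Sum>x\<in>E. u x) powr a"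
proof -
  let ?T = "\<Sum>x\<in>E. u x"
  have split: "v powr a = v * v powr (a - 1)" if "v \<ge> 0" for v :: real
    using that powr_add[of v 1 "a - 1"] by (cases "v = 0") auto
  have T: "?T \<ge> 0" using assms by (intro sum_nonneg)
  have "(\<Sum>x\<in>E. u x powr a) \<le> (\<Sum>x\<in>E. u x * ?T powr (a - 1))"
  proof (rule sum_mono)
    fix x assume x: "x \<in> E"
    have "u x \<le> ?T" using assms x by (intro member_le_sum) auto
    then have "u x powr (a - 1) \<le> ?T powr (a - 1)" using assms x by (intro powr_mono2) auto
    then show "u x powr a \<le> u x * ?T powr (a - 1)"
      unfolding split[OF assms(2)[OF x]] using assms(2)[OF x] by (rule mult_left_mono)
  qed
  also have "\<dots> = ?T powr a" by (simp add: split[OF T] sum_distrib_right)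
  finally show ?thesis .
qed

section \<open>Quasi-norms on the discrete group\<close>

lemma nn_integral_haarX:
  "(\<integral>\<^sup>+ x. F x \<partial>haarX c) = ennreal c * (\<integral>\<^sup>+ x. F x \<partial>count_space UNIV)"
  unfolding haarX_def by (rule nn_integral_scale_measure) simp

lemma haarX_sum_le:
  assumes "c > 0" "a > 0" "Lnorm (haarX c) a f = 1" "finite E"
  shows "c * (\<Sum>x\<in>E. norm (f x) powr (1 / a)) \<le> 1"
proof -
  have "ennreal (c * (\<Sum>x\<in>E. norm (f x) powr (1 / a)))
      = ennreal c * (\<integral>\<^sup>+ x\<in>E. ennreal (norm (f x) powr (1 / a)) \<partial>count_space UNIV)"
    using assms by (simp add: ennreal_mult sum_nonneg nn_integral_count_space_indicator[symmetric]
        nn_integral_count_space_finite sum_ennreal)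
  also have "\<dots> \<le> ennreal c * (\<integral>\<^sup>+ x. ennreal (norm (f x) powr (1 / a)) \<partial>count_space UNIV)"
    by (intro mult_left_mono nn_integral_mono) (auto simp: indicator_def)
  also have "\<dots> \<le> ennreal (1 powr (1 / a))"
    using Lnorm_leD[of a "haarX c" f 1] assms by (simp add: nn_integral_haarX)
  finally show ?thesis by simp
qed

text \<open>Every point has mass c > 0, so only the empty set is null, and the essential supremum at
  a = 0 sees every single value.\<close>

lemma AE_haarX: "c > 0 \<Longrightarrow> (AE x in haarX c. P x) \<longleftrightarrow> (\<forall>x. P x)"
proof -
  assume c: "c > 0"
  have "(AE x in haarX c. P x) \<longleftrightarrow> (\<integral>\<^sup>+ x. indicator {x. \<not> P x} x \<partial>haarX c) = 0"
    by (subst nn_integral_0_iff_AE) (auto simp: haarX_def indicator_def)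
  also have "\<dots> \<longleftrightarrow> (\<forall>x. P x)"
    using c by (auto simp: nn_integral_haarX nn_integral_0_iff_AE AE_count_space indicator_def)
  finally show ?thesis .
qed

lemma Lnorm_haarX_const:
  assumes c: "c > 0" and t: "t \<ge> 0" and a: "a \<ge> 0" and E: "finite E" "E \<noteq> {}"
  shows "Lnorm (haarX c) a (\<lambda>x. if x \<in> E then of_real t else 0) = ennreal (t * (c * card E) powr a)"
proof (cases "a = 0")
  case True
  \<comment> \<open>At a = 0 the claimed value contains \<open>(c * card E) powr 0\<close>, which is
    1 only for a nonzero base, as \<open>0 powr 0 = 0\<close>.\<close>
  have N: "c * card E \<noteq> 0" using c E by simp
  have meas: "h \<in> borel_measurable (haarX c)" for h :: "'a \<Rightarrow> ennreal"
    by (simp add: haarX_def)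
  have "esssup (haarX c) (\<lambda>x. ennreal (norm (if x \<in> E then of_real t else 0 :: complex))) = ennreal t"
  proof (rule antisym)
    show "esssup (haarX c) (\<lambda>x. ennreal (norm (if x \<in> E then of_real t else 0 :: complex))) \<le> ennreal t"
      using t by (intro esssup_I meas AE_I2) auto
    obtain x where "x \<in> E" using E by blast
    then show "ennreal t \<le> esssup (haarX c) (\<lambda>x. ennreal (norm (if x \<in> E then of_real t else 0 :: complex)))"
      using esssup_AE[of "\<lambda>x. ennreal (norm (if x \<in> E then of_real t else 0 :: complex))" "haarX c"] t
      unfolding AE_haarX[OF c] by (auto dest: spec[of _ x])
  qed
  then show ?thesis using True N by (simp add: Lnorm_def)
next
  case False
  then have "a > 0" using a by simp
  have "(\<integral>\<^sup>+ x. ennreal (norm (if x \<in> E then of_real t else 0 :: complex) powr (1 / a)) \<partial>haarX c)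
      = ennreal c * (\<integral>\<^sup>+ x\<in>E. ennreal (t powr (1 / a)) \<partial>count_space UNIV)"
    unfolding nn_integral_haarX using t by (intro arg_cong2[where f = "(*)"] refl nn_integral_cong) auto
  also have "\<dots> = ennreal (c * card E * t powr (1 / a))"
  proof -
    have "(\<integral>\<^sup>+ x\<in>E. ennreal (t powr (1 / a)) \<partial>count_space UNIV) = ennreal (t powr (1 / a)) * of_nat (card E)"
      using E by (subst nn_integral_cmult_indicator) auto
    then show ?thesis
      using c by (simp add: ennreal_mult ennreal_of_nat_eq_real_of_nat mult_ac)
  qed
  finally have "Lnorm (haarX c) a (\<lambda>x. if x \<in> E then of_real t else 0) = ennreal ((c * card E * t powr (1 / a)) powr a)"
    using c by (intro Lnorm_eqI[OF \<open>a > 0\<close>]) auto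
  then show ?thesis using c t \<open>a > 0\<close> by (simp add: powr_mult powr_powr mult_ac)
qed

section \<open>Sharp upper bound, passage to the limit, and the extremal point mass\<close>

context dual_haar
begin

text \<open>The starting point is b0 = 1 - a by Hausdorff--Young if a < 1, and b0 = 0 by the l^1
  bound if a >= 1. Raising b0 to b costs (1/c)^(b-b0); in the second case a further (1/c)^(a-1)
  arises from writing c as (1/c)^(a-1) c^a, so both cases end with the same power.\<close>

lemma Lnorm_transform_le:
  assumes E: "finite E" and a: "1 / 2 \<le> a" and b: "0 \<le> b" "1 \<le> a + b"
  shows "Lnorm \<mu> b (transform E f)
    \<le> ennreal ((1 / c) powr (a + b - 1) * (c * (\<Sum>x\<in>E. norm (f x) powr (1 / a))) powr a)"
proof -
  let ?A = "c * (\<Sum>x\<in>E. norm (f x) powr (1 / a))"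
  have mono: "Lnorm \<mu> b (transform E f) \<le> ennreal ((1 / c) powr (b - b0)) * Lnorm \<mu> b0 (transform E f)"
    if "0 \<le> b0" "b0 \<le> b" for b0
    using that c_pos by (intro Lnorm_mono_exponent) (auto simp: emeasure_space_haar)
  show ?thesis
  proof (cases "a < 1")
    case True
    have "Lnorm \<mu> (1 - a) (transform E f) \<le> ennreal (?A powr a)"
    proof (rule Lnorm_leI)
      have "integrable \<mu> (\<lambda>\<gamma>. norm (transform E f \<gamma>) powr (1 / (1 - a)))"
        by (rule integrable_bounded_haar[where B = "(c * (\<Sum>x\<in>E. norm (f x))) powr (1 / (1 - a))"])
           (use True in \<open>auto intro!: powr_mono2 norm_transform_le\<close>)
      then have "(\<integral>\<^sup>+ \<gamma>. ennreal (norm (transform E f \<gamma>) powr (1 / (1 - a))) \<partial>\<mu>)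
          = ennreal (\<integral>\<gamma>. norm (transform E f \<gamma>) powr (1 / (1 - a)) \<partial>\<mu>)"
        by (rule nn_integral_eq_integral) simp
      then show "(\<integral>\<^sup>+ \<gamma>. ennreal (norm (transform E f \<gamma>) powr (1 / (1 - a))) \<partial>\<mu>)
          \<le> ennreal ((?A powr a) powr (1 / (1 - a)))"
        using hausdorff_young_finite[OF E a True, of f] by (simp add: ennreal_leI)
    qed (use True in auto)
    then have "ennreal ((1 / c) powr (b - (1 - a))) * Lnorm \<mu> (1 - a) (transform E f)
        \<le> ennreal ((1 / c) powr (b - (1 - a))) * ennreal (?A powr a)"
      by (rule mult_left_mono) simp
    also have "\<dots> = ennreal ((1 / c) powr (a + b - 1) * ?A powr a)"
      by (simp add: ennreal_mult algebra_simps)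
    finally show ?thesis using mono[of "1 - a"] True b by (simp add: algebra_simps)
  next
    case False
    let ?T = "\<Sum>x\<in>E. norm (f x) powr (1 / a)"
    have T: "?T \<ge> 0" by (rule sum_nonneg) simp
    have "(\<Sum>x\<in>E. norm (f x)) = (\<Sum>x\<in>E. (norm (f x) powr (1 / a)) powr a)"
      using False by (simp add: powr_powr)
    also have "\<dots> \<le> ?T powr a"
      using False by (intro sum_powr_le_powr_sum E) auto
    finally have "c * (\<Sum>x\<in>E. norm (f x)) \<le> c * ?T powr a"
      using c_pos by simp
    also have "\<dots> = (1 / c) powr (a - 1) * ?A powr a"
    proof -
      have "(1 / c) powr (a - 1) * c powr a = c"
        using c_pos by (simp add: powr_divide powr_diff)
      then show ?thesis using c_pos T by (simp add: powr_mult)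
    qed
    finally have le: "c * (\<Sum>x\<in>E. norm (f x)) \<le> (1 / c) powr (a - 1) * ?A powr a" .
    have "Lnorm \<mu> 0 (transform E f) \<le> ennreal ((1 / c) powr (a - 1) * ?A powr a)"
    proof -
      have "esssup \<mu> (\<lambda>\<gamma>. ennreal (norm (transform E f \<gamma>))) \<le> ennreal ((1 / c) powr (a - 1) * ?A powr a)"
        by (intro esssup_I AE_I2 ennreal_leI order_trans[OF norm_transform_le le]) auto
      then show ?thesis by (simp add: Lnorm_def)
    qed
    then have "ennreal ((1 / c) powr b) * Lnorm \<mu> 0 (transform E f)
        \<le> ennreal ((1 / c) powr b) * ennreal ((1 / c) powr (a - 1) * ?A powr a)"
      by (rule mult_left_mono) simp
    also have "\<dots> = ennreal ((1 / c) powr b * ((1 / c) powr (a - 1) * ?A powr a))"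
      by (simp add: ennreal_mult)
    also have "(1 / c) powr b * ((1 / c) powr (a - 1) * ?A powr a) = (1 / c) powr (a + b - 1) * ?A powr a"
      by (simp add: algebra_simps flip: powr_add)
    finally show ?thesis using mono[of 0] b by simp
  qed
qed

text \<open>The transform is an L^2 limit along the net of finite sets. Picking sets with squared
  error below 1/(n+1) gives a sequence whose squared errors tend to 0 in L^1, and a subsequence
  converges almost everywhere.\<close>

lemma fourier_truncations_AE:
  assumes "is_fourier c \<mu> f g"
  obtains E :: "nat \<Rightarrow> 'a set" where "\<And>n. finite (E n)" "AE \<gamma> in \<mu>. (\<lambda>n. transform (E n) f \<gamma>) \<longlonglongrightarrow> g \<gamma>"
proof -
  let ?J = "\<lambda>F. \<integral>\<^sup>+ \<gamma>. ennreal ((norm (g \<gamma> - transform F f \<gamma>))\<^sup>2) \<partial>\<mu>"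
  have [measurable]: "g \<in> borel_measurable \<mu>"
    and lim: "(?J \<longlongrightarrow> 0) (finite_subsets_at_top UNIV)"
    using assms by (auto simp: is_fourier_def transform_def)
  have "\<exists>F. finite F \<and> ?J F < ennreal (1 / Suc n)" for n
  proof -
    have "eventually (\<lambda>F. ?J F < ennreal (1 / Suc n)) (finite_subsets_at_top UNIV)"
      using lim by (rule order_tendstoD) simp
    then show ?thesis by (auto simp: eventually_finite_subsets_at_top)
  qed
  then obtain F where F: "\<And>n. finite (F n)" "\<And>n. ?J (F n) < ennreal (1 / Suc n)" by metis
  define u where "u n \<gamma> = (norm (g \<gamma> - transform (F n) f \<gamma>))\<^sup>2" for n \<gamma>
  have int: "integrable \<mu> (u n)" for n
    unfolding u_def by (rule integrableI_nonneg) (use order.strict_trans[OF F(2)[of n] ennreal_less_top] in auto)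
  have "(\<integral>\<gamma>. norm (u n \<gamma>) \<partial>\<mu>) \<le> 1 / Suc n" for n
  proof -
    have "ennreal (\<integral>\<gamma>. u n \<gamma> \<partial>\<mu>) = ?J (F n)"
      using nn_integral_eq_integral[OF int[of n]] by (simp add: u_def[abs_def])
    then have "ennreal (\<integral>\<gamma>. u n \<gamma> \<partial>\<mu>) \<le> ennreal (1 / Suc n)" using F(2)[of n] by simp
    then show ?thesis by (simp add: u_def ennreal_le_iff)
  qed
  then have "(\<lambda>n. \<integral>\<gamma>. norm (u n \<gamma>) \<partial>\<mu>) \<longlonglongrightarrow> 0"
    by (intro tendsto_sandwich[OF _ _ tendsto_const LIMSEQ_Suc[OF lim_1_over_n]] always_eventually) auto
  from tendsto_L1_AE_subseq[OF int this] obtain r :: "nat \<Rightarrow> nat"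
    where r: "AE \<gamma> in \<mu>. (\<lambda>n. u (r n) \<gamma>) \<longlonglongrightarrow> 0" by blast
  then have "AE \<gamma> in \<mu>. (\<lambda>n. transform (F (r n)) f \<gamma>) \<longlonglongrightarrow> g \<gamma>"
  proof eventually_elim
    case (elim \<gamma>)
    then have "(\<lambda>n. sqrt (u (r n) \<gamma>)) \<longlonglongrightarrow> sqrt 0" by (rule tendsto_real_sqrt)
    then have "(\<lambda>n. norm (transform (F (r n)) f \<gamma> - g \<gamma>)) \<longlonglongrightarrow> 0"
      by (simp add: u_def norm_minus_commute)
    then show ?case by (metis LIM_zero_cancel tendsto_norm_zero_iff)
  qed
  then show ?thesis using that[of "\<lambda>n. F (r n)"] F by blast
qed

text \<open>For b > 0 this is Fatou's lemma for the 1/b-th powers, valid for quasi-norms as well.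
  For b = 0 the countably many exceptional null sets are united before passing to the limit
  pointwise.\<close>

lemma Lnorm_limit_le:
  assumes meas [measurable]: "\<And>n. S n \<in> borel_measurable \<mu>" "g \<in> borel_measurable \<mu>"
    and lim: "AE \<gamma> in \<mu>. (\<lambda>n::nat. S n \<gamma>) \<longlonglongrightarrow> g \<gamma>"
    and le: "\<And>n. Lnorm \<mu> b (S n) \<le> ennreal K" and K: "K \<ge> 0" and b: "b \<ge> 0"
  shows "Lnorm \<mu> b g \<le> ennreal K"
proof (cases "b = 0")
  case True
  have "AE \<gamma> in \<mu>. ennreal (norm (S n \<gamma>)) \<le> ennreal K" for n
    using esssup_AE[of "\<lambda>\<gamma>. ennreal (norm (S n \<gamma>))" \<mu>] le[of n] True
    by (auto simp: Lnorm_def elim: eventually_mono order_trans)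
  then have "AE \<gamma> in \<mu>. \<forall>n. ennreal (norm (S n \<gamma>)) \<le> ennreal K" by (simp add: AE_all_countable)
  with lim have "AE \<gamma> in \<mu>. ennreal (norm (g \<gamma>)) \<le> ennreal K"
  proof eventually_elim
    case (elim \<gamma>)
    then have "norm (S n \<gamma>) \<le> K" for n using K by simp
    moreover have "(\<lambda>n. norm (S n \<gamma>)) \<longlonglongrightarrow> norm (g \<gamma>)" using elim by (intro tendsto_norm)
    ultimately have "norm (g \<gamma>) \<le> K" by (intro LIMSEQ_le_const2) auto
    then show ?case by (rule ennreal_leI)
  qed
  then have "esssup \<mu> (\<lambda>\<gamma>. ennreal (norm (g \<gamma>))) \<le> ennreal K" by (intro esssup_I) auto
  then show ?thesis using True by (simp add: Lnorm_def)
next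
  case False
  then have "b > 0" using b by simp
  show ?thesis
  proof (rule Lnorm_leI[OF \<open>b > 0\<close> _ K])
    have "(\<integral>\<^sup>+ \<gamma>. ennreal (norm (g \<gamma>) powr (1 / b)) \<partial>\<mu>)
        = (\<integral>\<^sup>+ \<gamma>. liminf (\<lambda>n. ennreal (norm (S n \<gamma>) powr (1 / b))) \<partial>\<mu>)"
    proof (rule nn_integral_cong_AE)
      show "AE \<gamma> in \<mu>. ennreal (norm (g \<gamma>) powr (1 / b)) = liminf (\<lambda>n. ennreal (norm (S n \<gamma>) powr (1 / b)))"
        using lim
      proof eventually_elim
        case (elim \<gamma>)
        have "(\<lambda>n. norm (S n \<gamma>) powr (1 / b)) \<longlonglongrightarrow> norm (g \<gamma>) powr (1 / b)"
          using elim \<open>b > 0\<close> by (intro tendsto_powr2 tendsto_norm) auto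
        then have "(\<lambda>n. ennreal (norm (S n \<gamma>) powr (1 / b))) \<longlonglongrightarrow> ennreal (norm (g \<gamma>) powr (1 / b))"
          by (rule tendsto_ennrealI)
        then show ?case by (rule lim_imp_Liminf[OF trivial_limit_sequentially, symmetric])
      qed
    qed
    also have "\<dots> \<le> liminf (\<lambda>n. \<integral>\<^sup>+ \<gamma>. ennreal (norm (S n \<gamma>) powr (1 / b)) \<partial>\<mu>)"
      by (rule nn_integral_liminf) simp
    also have "\<dots> \<le> ennreal (K powr (1 / b))"
      using Lnorm_leD[OF \<open>b > 0\<close> le K]
      by (intro Liminf_le) auto
    finally show "(\<integral>\<^sup>+ \<gamma>. ennreal (norm (g \<gamma>) powr (1 / b)) \<partial>\<mu>) \<le> ennreal (K powr (1 / b))" .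
  qed
qed

lemma Cpq_le:
  assumes a: "1 / 2 \<le> a" and b: "0 \<le> b" "1 \<le> a + b"
  shows "Cpq c \<mu> a b \<le> ennreal ((1 / c) powr (a + b - 1))"
  unfolding Cpq_def
proof (rule Sup_least, clarify)
  fix f g
  assume f: "Lnorm (haarX c) a f = 1" and g: "is_fourier c \<mu> f g"
  obtain E :: "nat \<Rightarrow> 'a set" where E: "\<And>n. finite (E n)"
    "AE \<gamma> in \<mu>. (\<lambda>n. transform (E n) f \<gamma>) \<longlonglongrightarrow> g \<gamma>"
    using fourier_truncations_AE[OF g] by blast
  show "Lnorm \<mu> b g \<le> ennreal ((1 / c) powr (a + b - 1))"
  proof (rule Lnorm_limit_le[OF _ _ E(2)])
    fix n
    let ?A = "c * (\<Sum>x\<in>E n. norm (f x) powr (1 / a))"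
    have "?A \<le> 1" using haarX_sum_le[OF c_pos _ f E(1)] a by simp
    moreover have "?A \<ge> 0" using c_pos by (auto intro!: mult_nonneg_nonneg sum_nonneg)
    ultimately have "?A powr a \<le> 1" using powr_mono2[of a ?A 1] a by simp
    then have "(1 / c) powr (a + b - 1) * ?A powr a \<le> (1 / c) powr (a + b - 1)"
      using mult_left_mono[of "?A powr a" 1 "(1 / c) powr (a + b - 1)"] by simp
    then show "Lnorm \<mu> b (transform (E n) f) \<le> ennreal ((1 / c) powr (a + b - 1))"
      using Lnorm_transform_le[OF E(1) a b] by (meson ennreal_leI order_trans)
  qed (use g b in \<open>auto simp: is_fourier_def\<close>)
qed

text \<open>The net of truncations is constant beyond \<open>E\<close>, and square integrability is
  the case a = b = 1/2 of the finite bound.\<close>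

lemma is_fourier_transform:
  assumes E: "finite E" and f: "\<And>x. x \<notin> E \<Longrightarrow> f x = 0"
  shows "is_fourier c \<mu> f (transform E f)"
  unfolding is_fourier_def
proof (intro conjI)
  have "Lnorm \<mu> (1/2) (transform E f)
      \<le> ennreal ((1 / c) powr (1/2 + 1/2 - 1) * (c * (\<Sum>x\<in>E. norm (f x) powr (1 / (1/2)))) powr (1/2))"
    by (rule Lnorm_transform_le[OF E]) auto
  then show "Lnorm \<mu> (1/2) (transform E f) < \<infinity>"
    by (rule le_less_trans) simp
  have "transform E f \<gamma> = (\<Sum>x\<in>F. of_real c * f x * cnj (\<gamma> x))" if "E \<subseteq> F" "finite F" for F \<gamma>
    unfolding transform_def using that f by (intro sum.mono_neutral_left) auto
  then have "eventually (\<lambda>F. (\<integral>\<^sup>+ \<gamma>. ennreal ((norm (transform E f \<gamma> - (\<Sum>x\<in>F. of_real c * f x * cnj (\<gamma> x))))\<^sup>2) \<partial>\<mu>) = 0)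
      (finite_subsets_at_top UNIV)"
    unfolding eventually_finite_subsets_at_top using E by (intro exI[of _ E]) auto
  then show "((\<lambda>F. \<integral>\<^sup>+ \<gamma>. ennreal ((norm (transform E f \<gamma> - (\<Sum>x\<in>F. of_real c * f x * cnj (\<gamma> x))))\<^sup>2) \<partial>\<mu>)
      \<longlongrightarrow> 0) (finite_subsets_at_top UNIV)"
    by (rule tendsto_eventually)
qed simp

text \<open>The test function is the indicator of \<open>E\<close> scaled by (c|E|)^(-a) to have
  norm 1. Its transform is the conjugate of the displayed sum, and \<open>Lnorm\<close> depends only
  on the modulus.\<close>

lemma Lnorm_sum_le_Cpq:
  assumes E: "finite E" "E \<noteq> {}" and a: "a \<ge> 0"
  shows "Lnorm \<mu> b (\<lambda>\<gamma>. of_real (c * (c * card E) powr (- a)) * (\<Sum>x\<in>E. \<gamma> x)) \<le> Cpq c \<mu> a b"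
proof -
  let ?t = "(c * card E) powr (- a)"
  let ?f = "\<lambda>x. if x \<in> E then complex_of_real ?t else 0"
  have "norm (of_real (c * ?t) * (\<Sum>x\<in>E. \<gamma> x)) = norm (transform E ?f \<gamma>)" for \<gamma> :: "'a \<Rightarrow> complex"
  proof -
    have "transform E ?f \<gamma> = of_real (c * ?t) * cnj (\<Sum>x\<in>E. \<gamma> x)"
      by (simp add: transform_def sum_distrib_left)
    then show ?thesis by (simp add: norm_mult del: cnj_sum)
  qed
  then have "Lnorm \<mu> b (\<lambda>\<gamma>. of_real (c * ?t) * (\<Sum>x\<in>E. \<gamma> x)) = Lnorm \<mu> b (transform E ?f)"
    by (intro Lnorm_cong) auto
  also have "\<dots> \<le> Cpq c \<mu> a b"
    unfolding Cpq_def
  proof (rule Sup_upper, intro CollectI exI conjI)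
    show "Lnorm (haarX c) (1/2) ?f < \<infinity>"
      using E c_pos by (subst Lnorm_haarX_const) auto
    have "?t * (c * card E) powr a = 1" using E c_pos by (simp flip: powr_add)
    then show "Lnorm (haarX c) a ?f = 1"
      using E c_pos a by (subst Lnorm_haarX_const) auto
    show "is_fourier c \<mu> ?f (transform E ?f)"
      using E by (intro is_fourier_transform) auto
  qed simp
  finally show ?thesis .
qed

text \<open>For \<open>E\<close> = {0} the transform is the constant c^(1-a), whose norm on a space
  of mass 1/c is c^(1-a) (1/c)^b; this equals the upper bound.\<close>

lemma Cpq_eq:
  assumes a: "1 / 2 \<le> a" and b: "0 \<le> b" "1 \<le> a + b"
  shows "Cpq c \<mu> a b = ennreal ((1 / c) powr (a + b - 1))"
proof (rule antisym[OF Cpq_le[OF assms]])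
  let ?k = "c * c powr (- a)"
  have k: "?k > 0" using c_pos by simp
  have "Lnorm \<mu> b (\<lambda>\<gamma>. of_real (c * (c * card {0::'a}) powr (- a)) * (\<Sum>x\<in>{0}. \<gamma> x)) = Lnorm \<mu> b (\<lambda>\<gamma>. of_real ?k)"
    using c_pos by (intro Lnorm_cong) (auto simp: dual_group_0 norm_mult)
  moreover have "Lnorm \<mu> b (\<lambda>\<gamma>. of_real ?k) = ennreal ((1 / c) powr (a + b - 1))"
  proof -
    have e: "(1 / c) powr (a + b - 1) = ?k * (1 / c) powr b"
    proof -
      have "?k * (1 / c) powr b = c powr 1 * c powr (- a) * c powr (- b)"
        using c_pos by (simp add: powr_divide powr_minus_divide)
      also have "\<dots> = c powr - (a + b - 1)" by (simp only: powr_add[symmetric]) (simp add: algebra_simps)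
      also have "\<dots> = (1 / c) powr (a + b - 1)" using c_pos powr_minus_divide[of c "a + b - 1"] by (simp add: powr_divide)
      finally show ?thesis by simp
    qed
    show ?thesis
    proof (cases "b = 0")
      case True
      have "esssup \<mu> (\<lambda>\<gamma>. ennreal ?k) = ennreal ?k"
        by (rule esssup_const) (use c_pos in \<open>simp add: emeasure_space_haar\<close>)
      moreover have "norm (complex_of_real ?k) = ?k" using k by (simp only: norm_of_real abs_of_pos)
      ultimately show ?thesis using True c_pos unfolding e by (simp add: Lnorm_def del: of_real_mult)
    next
      case False
      then have "b > 0" using b by simp
      have "Lnorm \<mu> b (\<lambda>\<gamma>. of_real ?k) = ennreal ((?k powr (1 / b) * (1 / c)) powr b)"
        using k c_pos by (intro Lnorm_eqI[OF \<open>b > 0\<close>])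
          (simp_all add: emeasure_space_haar ennreal_mult[symmetric] del: of_real_mult)
      moreover have "(?k powr (1 / b) * (1 / c)) powr b = ?k powr (1 / b * b) * (1 / c) powr b"
        by (simp only: powr_mult[of "?k powr (1 / b)" "1 / c"] powr_powr)
      moreover have "?k powr (1 / b * b) = ?k" using \<open>b > 0\<close> k by simp
      ultimately show ?thesis unfolding e by simp
    qed
  qed
  ultimately show "ennreal ((1 / c) powr (a + b - 1)) \<le> Cpq c \<mu> a b"
    using Lnorm_sum_le_Cpq[of "{0}" a b] a by simp
qed

end

subsection \<open>Additive energy\<close>

text \<open>\<open>K\<close> absorbs the fixed loss from Hoelder's inequality. Only arbitrarily
  large N are asked for, because the high-energy sets are not constructed with every
  cardinality.\<close>

lemma powr_unbounded_imp_top: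
  assumes "d > 0" "e > 0" and bound: "\<And>n. \<exists>N\<ge>n. ennreal (d * real N powr e) \<le> ennreal K * C"
  shows "C = \<infinity>"
proof (rule ccontr)
  assume "C \<noteq> \<infinity>"
  then have "ennreal K * C < \<infinity>" by (simp add: ennreal_mult_less_top less_top)
  then obtain r where r: "ennreal K * C = ennreal r" "r \<ge> 0" by (cases "ennreal K * C") auto
  obtain n :: nat where n0: "(r / d) powr (1 / e) < real n" using reals_Archimedean2 by blast
  have n: "d * real N powr e > r" if "N \<ge> n" for N
  proof -
    have "((r / d) powr (1 / e)) powr e < real N powr e"
      using n0 that \<open>e > 0\<close> by (intro powr_less_mono2) auto
    then have "r / d < real N powr e" using assms r by (simp add: powr_powr)
    then show ?thesis using \<open>d > 0\<close> by (simp add: field_simps)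
  qed
  obtain N where "N \<ge> n" "ennreal (d * real N powr e) \<le> ennreal r" using bound[of n] r by auto
  then show False using n[of N] r by simp
qed

text \<open>A Sidon set would not allow \<open>x = z\<close> or \<open>y = w\<close>; in a group with much 2-torsion these cannot be
  avoided, but they contribute only \<open>O(N\<^sup>2)\<close> to the energy.\<close>

definition sidon_like :: "'a::ab_group_add set \<Rightarrow> bool" where
  "sidon_like E \<longleftrightarrow> (\<forall>x\<in>E. \<forall>y\<in>E. \<forall>z\<in>E. \<forall>w\<in>E. x - y + (z - w) = 0 \<longrightarrow> x = y \<or> x = w \<or> x = z \<or> y = w)"

text \<open>Greedy choice: the new element avoids all p - q + r with entries in \<open>E\<close>, so
  it cannot be the only entry outside \<open>E\<close> in a solution of the equation.\<close>

lemma sidon_like_exists: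
  assumes "infinite (UNIV :: 'a::ab_group_add set)"
  shows "\<exists>E :: 'a set. finite E \<and> card E = n \<and> sidon_like E"
proof (induction n)
  case 0
  then show ?case by (intro exI[of _ "{}"]) (simp add: sidon_like_def)
next
  case (Suc n)
  then obtain E :: "'a set" where E: "finite E" "card E = n" "sidon_like E" by blast
  let ?F = "(\<lambda>(p, q, r). p - q + r) ` (E \<times> E \<times> E)"
  have "finite (?F \<union> E)" using E by simp
  then obtain t where t: "t \<notin> ?F" "t \<notin> E" using ex_new_if_finite[OF assms] by blast
  have tF: "t \<noteq> p - q + r" if "p \<in> E" "q \<in> E" "r \<in> E" for p q r
    using t(1) that by force
  have "sidon_like (insert t E)"
    unfolding sidon_like_def
  proof (intro ballI impI, rule ccontr)
    fix x y z w
    assume m: "x \<in> insert t E" "y \<in> insert t E" "z \<in> insert t E" "w \<in> insert t E"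
      and 0: "x - y + (z - w) = 0" and n: "\<not> (x = y \<or> x = w \<or> x = z \<or> y = w)"
    \<comment> \<open>With these two, all four entries are distinct, so \<open>t\<close> occurs at
      most once and the other entries lie in \<open>E\<close>.\<close>
    have yz: "y \<noteq> z" and zw: "z \<noteq> w" using 0 n by auto
    have eqs: "x = y - z + w" "y = x - w + z" "z = y - x + w" "w = x - y + z"
      using 0 by (simp_all add: algebra_simps add_eq_0_iff2)
    consider "x = t" | "y = t" | "z = t" | "w = t" | "x \<in> E" "y \<in> E" "z \<in> E" "w \<in> E" using m by blast
    then show False
    proof cases
      case 1 then show ?thesis using tF[of y z w] m n yz zw eqs(1) by auto
    next
      case 2 then show ?thesis using tF[of x w z] m n yz zw eqs(2) by auto
    next
      case 3 then show ?thesis using tF[of y x w] m n yz zw eqs(3) by auto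
    next
      case 4 then show ?thesis using tF[of x y z] m n yz zw eqs(4) by auto
    next
      case 5 then show ?thesis using E(3) 0 n unfolding sidon_like_def by blast
    qed
  qed
  then show ?case using E t by (intro exI[of _ "insert t E"]) simp
qed

text \<open>Each of the four coincidences leaves two free entries and determines the other two, so
  it contributes at most |E|^2 quadruples.\<close>

lemma energy_sidon_like_le:
  assumes E: "finite E" "sidon_like E"
  shows "energy E \<le> 4 * (card E)\<^sup>2"
proof -
  let ?Q = "{((x, y), (z, w)). x \<in> E \<and> y \<in> E \<and> z \<in> E \<and> w \<in> E \<and> x - y + (z - w) = 0}"
  let ?I = "\<lambda>h. h ` (E \<times> E)"
  let ?h1 = "\<lambda>(x, z). ((x, x), (z, z))" and ?h2 = "\<lambda>(x, y). ((x, y), (y, x))"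
  let ?h3 = "\<lambda>(x, y). ((x, y), (x, x - y + x))" and ?h4 = "\<lambda>(x, y). ((x, y), (y + y - x, y))"
  have "?Q \<subseteq> (?I ?h1 \<union> ?I ?h2) \<union> (?I ?h3 \<union> ?I ?h4)"
  proof
    fix q assume "q \<in> ?Q"
    then obtain x y z w where q: "q = ((x, y), (z, w))"
      and m: "x \<in> E" "y \<in> E" "z \<in> E" "w \<in> E" and 0: "x - y + (z - w) = 0" by blast
    have w: "w = x - y + z" using 0 by (simp add: algebra_simps)
    have z: "z = y + w - x" unfolding w by simp
    have "x = y \<or> x = w \<or> x = z \<or> y = w" using E(2) m 0 unfolding sidon_like_def by blast
    moreover have "q \<in> ?I ?h1" if "x = y" using that q m w by (auto simp: image_iff)
    moreover have "q \<in> ?I ?h2" if "x = w" using that q m z by (auto simp: image_iff)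
    moreover have "q \<in> ?I ?h3" if "x = z" using that q m w by (auto simp: image_iff)
    moreover have "q \<in> ?I ?h4" if "y = w" using that q m z by (auto simp: image_iff)
    ultimately show "q \<in> (?I ?h1 \<union> ?I ?h2) \<union> (?I ?h3 \<union> ?I ?h4)" by blast
  qed
  then have "card ?Q \<le> card ((?I ?h1 \<union> ?I ?h2) \<union> (?I ?h3 \<union> ?I ?h4))"
    using E by (intro card_mono) auto
  also have "\<dots> \<le> (card (?I ?h1) + card (?I ?h2)) + (card (?I ?h3) + card (?I ?h4))"
    by (intro order_trans[OF card_Un_le] add_mono card_Un_le)
  also have "\<dots> \<le> (card (E \<times> E) + card (E \<times> E)) + (card (E \<times> E) + card (E \<times> E))"
    using E by (intro add_mono card_image_le) auto
  also have "\<dots> = 4 * (card E)\<^sup>2" by (simp add: card_cartesian_product power2_eq_square)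
  finally show ?thesis unfolding energy_def .
qed

text \<open>\<open>A\<close> only parametrizes solutions by three free entries: an initial segment
  of the naturals for progressions, the set itself for subgroups.\<close>

lemma energy_ge:
  assumes E: "finite E"
    and f: "inj_on f (A \<times> A \<times> A)" "\<And>i j k. i \<in> A \<Longrightarrow> j \<in> A \<Longrightarrow> k \<in> A \<Longrightarrow>
      f (i, j, k) \<in> {((x, y), (z, w)). x \<in> E \<and> y \<in> E \<and> z \<in> E \<and> w \<in> E \<and> x - y + (z - w) = 0}"
  shows "(card A) ^ 3 \<le> energy E"
proof -
  let ?Q = "{((x, y), (z, w)). x \<in> E \<and> y \<in> E \<and> z \<in> E \<and> w \<in> E \<and> x - y + (z - w) = 0}"
  have "finite ?Q" by (rule finite_subset[of _ "(E \<times> E) \<times> (E \<times> E)"]) (use E in auto)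
  moreover have "f ` (A \<times> A \<times> A) \<subseteq> ?Q"
  proof (rule image_subsetI)
    fix p assume "p \<in> A \<times> A \<times> A"
    then obtain i j k where p: "p = (i, j, k)" "i \<in> A" "j \<in> A" "k \<in> A" by blast
    show "f p \<in> ?Q" unfolding p(1) by (rule f(2)) (fact p)+
  qed
  ultimately have "card (A \<times> A \<times> A) \<le> card ?Q"
    using f(1) by (intro card_inj_on_le)
  then show ?thesis by (simp add: energy_def card_cartesian_product power3_eq_cube mult.assoc)
qed

lemma progression_energy:
  fixes x :: "'a::ab_group_add"
  assumes "\<And>k. k > 0 \<Longrightarrow> nmul k x \<noteq> 0" "M > 0"
  shows "\<exists>E::'a set. finite E \<and> card E = 3 * M \<and> M ^ 3 \<le> energy E"
proof -
  have inj: "i = j" if "nmul i x = nmul j x" for i j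
  proof -
    have *: "i = j" if "i \<le> j" "nmul i x = nmul j x" for i j
    proof -
      have "nmul j x = nmul i x + nmul (j - i) x" using that(1) by (metis le_add_diff_inverse nmul_add)
      then have "nmul (j - i) x = 0" using that(2) by simp
      then show ?thesis using assms(1)[of "j - i"] that(1) by fastforce
    qed
    show ?thesis using *[of i j] *[of j i] that by (metis nat_le_linear)
  qed
  let ?m = "\<lambda>i. nmul i x"
  let ?E = "?m ` {..<3 * M}"
  \<comment> \<open>Shifting by \<open>M\<close> keeps the fourth index M + i + k - j between 1 and
    3M - 2, so the natural subtraction is exact and all four points stay in the progression; this is
    why its length is 3M.\<close>
  let ?f = "\<lambda>(i, j, k). ((?m (M + i), ?m (M + j)), (?m (M + k), ?m (M + i + k - j)))"
  have "card ?E = 3 * M" using inj by (subst card_image) (auto intro: inj_onI)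
  moreover have "card {..<M} ^ 3 \<le> energy ?E"
  proof (rule energy_ge[where f = ?f])
    show "inj_on ?f ({..<M} \<times> {..<M} \<times> {..<M})" by (auto intro!: inj_onI dest!: inj)
    fix i j k assume ijk: "i \<in> {..<M}" "j \<in> {..<M}" "k \<in> {..<M}"
    have "(M + j) + (M + i + k - j) = (M + i) + (M + k)" using ijk by auto
    then have "?m (M + j) + ?m (M + i + k - j) = ?m (M + i) + ?m (M + k)" by (metis nmul_add)
    then have "?m (M + i) - ?m (M + j) + (?m (M + k) - ?m (M + i + k - j)) = 0"
      by (simp add: algebra_simps)
    then show "?f (i, j, k) \<in> {((x, y), (z, w)). x \<in> ?E \<and> y \<in> ?E \<and> z \<in> ?E \<and> w \<in> ?E \<and> x - y + (z - w) = 0}"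
      using ijk by auto
  qed simp
  ultimately show ?thesis by (intro exI[of _ ?E]) simp
qed

text \<open>Adjoining an element outside a finite subgroup gives a strictly larger subgroup, and it
  is again finite because the new element has finite order: multiples may be reduced modulo that
  order.\<close>

lemma finite_subgroup_exists:
  assumes inf: "infinite (UNIV :: 'a::ab_group_add set)"
    and tor: "\<And>x::'a. \<exists>k>0. nmul k x = 0"
  shows "\<exists>S :: 'a set. finite S \<and> n \<le> card S \<and> 0 \<in> S \<and> (\<forall>x\<in>S. \<forall>y\<in>S. x - y \<in> S)"
proof (induction n)
  case 0
  then show ?case by (intro exI[of _ "{0}"]) simp
next
  case (Suc n)
  then obtain S :: "'a set" where S: "finite S" "n \<le> card S" "0 \<in> S" "\<And>x y. x \<in> S \<Longrightarrow> y \<in> S \<Longrightarrow> x - y \<in> S"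
    by blast
  obtain y where y: "y \<notin> S" using ex_new_if_finite[OF inf S(1)] by blast
  obtain m where m: "m > 0" "nmul m y = 0" using tor by blast
  have mult0: "nmul (k * m) y = 0" for k
    using m by (simp add: nmul_mult) (simp add: nmul_def)
  let ?S = "{s + nmul i y | s i. s \<in> S}"
  have "?S \<subseteq> (\<lambda>(s, i). s + nmul i y) ` (S \<times> {..<m})"
  proof clarify
    fix s i assume "s \<in> S"
    have "nmul i y = nmul (i div m * m) y + nmul (i mod m) y" by (simp flip: nmul_add)
    then have "nmul i y = nmul (i mod m) y" using mult0 by simp
    then show "s + nmul i y \<in> (\<lambda>(s, i). s + nmul i y) ` (S \<times> {..<m})"
      using \<open>s \<in> S\<close> m(1) by (intro image_eqI[of _ _ "(s, i mod m)"]) auto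
  qed
  then have fin: "finite ?S" by (rule finite_subset) (use S(1) in auto)
  have sub: "S \<subseteq> ?S" by (force intro: exI[of _ 0])
  have "y \<in> ?S" using S(3) by (intro CollectI exI[of _ 0] exI[of _ "Suc 0"]) simp
  then have "S \<subset> ?S" using sub y by blast
  then have "card S < card ?S" using fin by (rule psubset_card_mono[rotated])
  moreover have "u - v \<in> ?S" if uv: "u \<in> ?S" "v \<in> ?S" for u v
  proof -
    obtain s i s' j where e: "u = s + nmul i y" "s \<in> S" "v = s' + nmul j y" "s' \<in> S" using uv by blast
    \<comment> \<open>As m y = 0, the negative of j y is the natural multiple j (m - 1) y, so
      differences stay in the set.\<close>
    have "j * (m - 1) + j = j * m" using m(1) by (cases m) auto
    then have "nmul (i + j * (m - 1)) y + nmul j y = nmul i y + nmul (j * m) y"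
      by (metis add.assoc nmul_add)
    then have "nmul i y - nmul j y = nmul (i + j * (m - 1)) y" using mult0 by (simp add: algebra_simps)
    then have "u - v = (s - s') + nmul (i + j * (m - 1)) y" unfolding e(1,3) by (simp add: algebra_simps)
    then show ?thesis using S(4)[OF e(2,4)] by blast
  qed
  moreover have "0 \<in> ?S" using sub S(3) by blast
  ultimately show ?case using fin S(2) by (intro exI[of _ ?S]) auto
qed

text \<open>The 27 is 3^3: a progression of length 3M has at least M^3 solutions. In a subgroup any
  three entries determine a fourth, which gives N^3 without loss.\<close>

lemma high_energy_exists:
  assumes inf: "infinite (UNIV :: 'a::ab_group_add set)"
  shows "\<exists>E::'a set. finite E \<and> n \<le> card E \<and> card E > 0 \<and> real (card E) ^ 3 / 27 \<le> real (energy E)"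
proof (cases "\<exists>x::'a. \<forall>k>0. nmul k x \<noteq> 0")
  case True
  then obtain x :: 'a where x: "\<And>k. k > 0 \<Longrightarrow> nmul k x \<noteq> 0" by blast
  obtain E :: "'a set" where E: "finite E" "card E = 3 * Suc n" "Suc n ^ 3 \<le> energy E"
    using progression_energy[OF x, of "Suc n"] by blast
  have "real (card E) ^ 3 / 27 = real (Suc n ^ 3)" using E(2) by (simp add: power3_eq_cube algebra_simps)
  also have "\<dots> \<le> real (energy E)" using E(3) by (simp only: of_nat_le_iff)
  finally show ?thesis using E by (intro exI[of _ E]) auto
next
  case False
  then obtain S :: "'a set" where S: "finite S" "Suc n \<le> card S" "0 \<in> S" "\<And>x y. x \<in> S \<Longrightarrow> y \<in> S \<Longrightarrow> x - y \<in> S"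
    using finite_subgroup_exists[OF inf, of "Suc n"] by blast
  have add: "x + y \<in> S" if "x \<in> S" "y \<in> S" for x y
    using S(4)[OF that(1) S(4)[OF S(3) that(2)]] by simp
  have "card S ^ 3 \<le> energy S"
    by (rule energy_ge[where f = "\<lambda>(x, y, z). ((x, y), (z, x - y + z))"])
       (use S add in \<open>auto intro!: inj_onI\<close>)
  then have "real (card S) ^ 3 \<le> real (energy S)" by (metis of_nat_le_iff of_nat_power)
  moreover have "real (card S) ^ 3 / 27 \<le> real (card S) ^ 3" by simp
  ultimately have "real (card S) ^ 3 / 27 \<le> real (energy S)" by linarith
  then show ?thesis using S by (intro exI[of _ S]) auto
qed

subsection \<open>The infinite regions\<close>

text \<open>With v = u/l this is v (v-1)^2 (v+2) >= 0, that is 3v^2 - v^4 <= 2v. Integrated, it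
  bounds a first moment below by second and fourth moments; the double zero puts the contact at u =
  l, so \<open>l\<close> should be of the typical size of u.\<close>

lemma quartic_lower_bound:
  fixes u l :: real
  assumes "u \<ge> 0" "l > 0"
  shows "(3 * u\<^sup>2 - u ^ 4 / l\<^sup>2) / (2 * l) \<le> u"
proof -
  define v where "v = u / l"
  have u: "u = l * v" using assms by (simp add: v_def)
  have "v \<ge> 0" using assms by (simp add: v_def)
  then have "0 \<le> v * (v - 1)\<^sup>2 * (v + 2)" by simp
  also have "\<dots> = v ^ 4 + 2 * v - 3 * v\<^sup>2"
    by (simp add: power2_eq_square power4_eq_xxxx algebra_simps)
  finally have "l\<^sup>2 * (3 * v\<^sup>2 - v ^ 4) \<le> l\<^sup>2 * (2 * v)"
    using assms by (intro mult_left_mono) auto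
  moreover have "3 * u\<^sup>2 - u ^ 4 / l\<^sup>2 = l\<^sup>2 * (3 * v\<^sup>2 - v ^ 4)"
    using assms by (simp add: u power2_eq_square power4_eq_xxxx algebra_simps)
  moreover have "u * (2 * l) = l\<^sup>2 * (2 * v)" by (simp add: u power2_eq_square)
  ultimately have "3 * u\<^sup>2 - u ^ 4 / l\<^sup>2 \<le> u * (2 * l)" by simp
  then show ?thesis using assms by (simp add: pos_divide_le_eq)
qed

section \<open>Moments of exponential sums and divergence of the operator norm\<close>

context dual_haar
begin

abbreviation exp_sum :: "'a set \<Rightarrow> ('a \<Rightarrow> complex) \<Rightarrow> complex" where
  "exp_sum E \<gamma> \<equiv> (\<Sum>x\<in>E. \<gamma> x)"

lemma norm_exp_sum_le: "\<gamma> \<in> dual_group \<Longrightarrow> norm (exp_sum E \<gamma>) \<le> card E"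
  using sum_norm_le[of E \<gamma> "\<lambda>_. 1"] by (simp add: dual_groupD)

lemma integrable_exp_sum_power: "integrable \<mu> (\<lambda>\<gamma>. norm (exp_sum E \<gamma>) ^ k)"
  by (rule integrable_bounded_haar[where B = "real (card E) ^ k"])
     (auto intro!: power_mono norm_exp_sum_le)

lemma integrable_exp_sum_powr: "p \<ge> 0 \<Longrightarrow> integrable \<mu> (\<lambda>\<gamma>. norm (exp_sum E \<gamma>) powr p)"
  by (rule integrable_bounded_haar[where B = "real (card E) powr p"])
     (auto intro!: powr_mono2 norm_exp_sum_le)

lemma second_moment:
  assumes "finite E"
  shows "(\<integral>\<gamma>. norm (exp_sum E \<gamma>) ^ 2 \<partial>\<mu>) = card E / c"
proof -
  have "norm (transform E (\<lambda>_. of_real (1 / c)) \<gamma>) = norm (exp_sum E \<gamma>)" for \<gamma>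
  proof -
    have "transform E (\<lambda>_. of_real (1 / c)) \<gamma> = cnj (exp_sum E \<gamma>)"
      using c_pos by (simp add: transform_def)
    then show ?thesis by (simp only: complex_mod_cnj)
  qed
  then show ?thesis
    using parseval[OF assms, of "\<lambda>_. of_real (1 / c)"] c_pos
    by (simp add: norm_divide power2_eq_square)
qed

lemma Lnorm_exp_sum_geI:
  assumes "b > 0" "k \<ge> 0" "L \<ge> 0" "L \<le> (\<integral>\<gamma>. norm (exp_sum E \<gamma>) powr (1 / b) \<partial>\<mu>)"
  shows "ennreal (k * L powr b) \<le> Lnorm \<mu> b (\<lambda>\<gamma>. of_real k * exp_sum E \<gamma>)"
proof (rule Lnorm_geI[OF \<open>b > 0\<close>])
  have "(k * L powr b) powr (1 / b) = k powr (1 / b) * L"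
    using assms by (simp add: powr_mult powr_powr)
  also have "\<dots> \<le> k powr (1 / b) * (\<integral>\<gamma>. norm (exp_sum E \<gamma>) powr (1 / b) \<partial>\<mu>)"
    using assms by (intro mult_left_mono) auto
  also have "\<dots> = (\<integral>\<gamma>. norm (of_real k * exp_sum E \<gamma>) powr (1 / b) \<partial>\<mu>)"
    using assms by (simp add: norm_mult powr_mult)
  finally have "ennreal ((k * L powr b) powr (1 / b))
      \<le> ennreal (\<integral>\<gamma>. norm (of_real k * exp_sum E \<gamma>) powr (1 / b) \<partial>\<mu>)" by (rule ennreal_leI)
  also have "\<dots> = (\<integral>\<^sup>+ \<gamma>. ennreal (norm (of_real k * exp_sum E \<gamma>) powr (1 / b)) \<partial>\<mu>)"
    using assms integrable_exp_sum_powr[of "1 / b" E]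
    by (intro nn_integral_eq_integral[symmetric]) (auto simp: norm_mult powr_mult)
  finally show "ennreal ((k * L powr b) powr (1 / b))
      \<le> (\<integral>\<^sup>+ \<gamma>. ennreal (norm (of_real k * exp_sum E \<gamma>) powr (1 / b)) \<partial>\<mu>)" .
qed (use assms in auto)

text \<open>Allows the lower bound to be computed at a larger, more convenient reciprocal exponent;
  the loss does not depend on \<open>E\<close>.\<close>

lemma Lnorm_exp_sum_le_Cpq:
  assumes "finite E" "E \<noteq> {}" "a \<ge> 0" "0 \<le> b" "b \<le> b'"
  shows "Lnorm \<mu> b' (\<lambda>\<gamma>. of_real (c * (c * card E) powr (- a)) * exp_sum E \<gamma>)
    \<le> ennreal ((1 / c) powr (b' - b)) * Cpq c \<mu> a b"
proof -
  let ?g = "\<lambda>\<gamma>. of_real (c * (c * card E) powr (- a)) * exp_sum E \<gamma>"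
  have "Lnorm \<mu> b' ?g \<le> ennreal ((1 / c) powr (b' - b)) * Lnorm \<mu> b ?g"
    using assms c_pos by (intro Lnorm_mono_exponent) (auto simp: emeasure_space_haar)
  also have "\<dots> \<le> ennreal ((1 / c) powr (b' - b)) * Cpq c \<mu> a b"
    by (intro mult_left_mono Lnorm_sum_le_Cpq assms) simp
  finally show ?thesis .
qed

lemma first_moment_ge:
  assumes E: "finite E" "E \<noteq> {}" "sidon_like E"
  shows "sqrt (card E) / (2 * c) \<le> (\<integral>\<gamma>. norm (exp_sum E \<gamma>) \<partial>\<mu>)"
proof -
  let ?N = "real (card E)" and ?T = "\<lambda>\<gamma>. norm (exp_sum E \<gamma>)"
  have N: "?N > 0" using E by (simp add: card_gt_0_iff)
  \<comment> \<open>Then l^2 = 4N, so an energy of at most 4 N^2 subtracts at most N from 3N and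
    leaves 2N.\<close>
  define l where "l = 2 * sqrt ?N"
  have l: "l > 0" "l\<^sup>2 = 4 * ?N" using N by (auto simp: l_def power_mult_distrib)
  have energy: "real (energy E) \<le> 4 * ?N\<^sup>2"
    using energy_sidon_like_le[OF E(1,3)] by (metis (mono_tags) of_nat_le_iff of_nat_mult of_nat_numeral of_nat_power)
  have "(3 * ?N - real (energy E) / l\<^sup>2) / (2 * l * c)
      = (\<integral>\<gamma>. (3 * ?T \<gamma> ^ 2 - ?T \<gamma> ^ 4 / l\<^sup>2) / (2 * l) \<partial>\<mu>)"
    using c_pos l(1) by (simp add: integrable_exp_sum_power second_moment fourth_moment E field_simps)
  also have "\<dots> \<le> (\<integral>\<gamma>. ?T \<gamma> \<partial>\<mu>)"
  proof (rule integral_mono)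
    show "integrable \<mu> (\<lambda>\<gamma>. (3 * ?T \<gamma> ^ 2 - ?T \<gamma> ^ 4 / l\<^sup>2) / (2 * l))"
      by (simp add: integrable_exp_sum_power)
    show "integrable \<mu> ?T" using integrable_exp_sum_power[of E 1] by simp
  qed (rule quartic_lower_bound[OF norm_ge_zero l(1)])
  finally have "(3 * ?N - real (energy E) / l\<^sup>2) / (2 * l * c) \<le> (\<integral>\<gamma>. ?T \<gamma> \<partial>\<mu>)" .
  moreover have "sqrt ?N / (2 * c) \<le> (3 * ?N - real (energy E) / l\<^sup>2) / (2 * l * c)"
  proof -
    have "real (energy E) / l\<^sup>2 \<le> ?N" using energy N unfolding l(2) by (simp add: field_simps power2_eq_square)
    then have "(2 * ?N) / (2 * l * c) \<le> (3 * ?N - real (energy E) / l\<^sup>2) / (2 * l * c)"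
      using l c_pos by (intro divide_right_mono) auto
    moreover have "(2 * ?N) / (2 * l * c) = sqrt ?N / (2 * c)"
      using N c_pos by (simp add: l_def field_simps)
    ultimately show ?thesis by simp
  qed
  ultimately show ?thesis by simp
qed

text \<open>The growth N^(1/2-a) is established for the L^1 norm, i.e. at reciprocal exponent 1, and
  transfers to every b <= 1 by Hoelder's inequality.\<close>

lemma Cpq_infinite_sidon:
  assumes inf: "infinite (UNIV :: 'a set)" and a: "0 \<le> a" "a < 1 / 2" and b: "0 \<le> b" "b \<le> 1"
  shows "Cpq c \<mu> a b = \<infinity>"
proof (rule powr_unbounded_imp_top)
  show "c powr (- a) / 2 > 0" "1 / 2 - a > 0" using c_pos a by auto
  fix n
  obtain E :: "'a set" where E: "finite E" "card E = Suc n" "sidon_like E"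
    using sidon_like_exists[OF inf, of "Suc n"] by blast
  let ?N = "real (card E)"
  have ne: "E \<noteq> {}" and N: "?N > 0" using E by auto
  let ?k = "c * (c * ?N) powr (- a)"
  have "ennreal (?k * (sqrt ?N / (2 * c)) powr 1) \<le> Lnorm \<mu> 1 (\<lambda>\<gamma>. of_real ?k * exp_sum E \<gamma>)"
    using first_moment_ge[OF E(1) ne E(3)] c_pos by (intro Lnorm_exp_sum_geI) auto
  also have "\<dots> \<le> ennreal ((1 / c) powr (1 - b)) * Cpq c \<mu> a b"
    by (rule Lnorm_exp_sum_le_Cpq) (use E ne a b in auto)
  also have "?k * (sqrt ?N / (2 * c)) powr 1 = c powr (- a) / 2 * ?N powr (1 / 2 - a)"
  proof -
    have "?N powr (1 / 2 - a) = ?N powr (1 / 2) * ?N powr (- a)"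
      by (simp flip: powr_add)
    then show ?thesis using c_pos N by (simp add: powr_mult powr_half_sqrt field_simps)
  qed
  finally show "\<exists>N\<ge>n. ennreal (c powr (- a) / 2 * real N powr (1 / 2 - a))
      \<le> ennreal ((1 / c) powr (1 - b)) * Cpq c \<mu> a b"
    using E by (intro exI[of _ "card E"]) simp
qed

text \<open>Where |S| <= e N, the fourth power is at most (e N)^2 |S|^2, whose integral is known
  exactly. The remaining fourth moment lives where |S| > e N, and there |S|^4 <= N^4 <= W
  |S|^q.\<close>

lemma high_moment_ge:
  assumes E: "finite E" "E \<noteq> {}" and q: "q > 2"
    and en: "real (card E) ^ 3 / 27 \<le> real (energy E)"
  shows "(1 / 54) powr (q / 2) / (54 * c) * real (card E) powr (q - 1)
    \<le> (\<integral>\<gamma>. norm (exp_sum E \<gamma>) powr q \<partial>\<mu>)"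
proof -
  let ?N = "real (card E)" and ?T = "\<lambda>\<gamma>. norm (exp_sum E \<gamma>)"
  have N: "?N > 0" using E by (simp add: card_gt_0_iff)
  \<comment> \<open>With e^2 = 1/54 the small values account for at most half of the lower bound
    N^3/(27 c) of the fourth moment.\<close>
  define e where "e = sqrt (1 / 54)"
  have e: "e > 0" "e\<^sup>2 = 1 / 54" by (auto simp: e_def)
  define W where "W = ?N ^ 4 / (e * ?N) powr q"
  have W: "W > 0" using N e by (simp add: W_def)
  have pw: "?T \<gamma> ^ 4 \<le> (e * ?N)\<^sup>2 * ?T \<gamma> ^ 2 + W * ?T \<gamma> powr q" if "\<gamma> \<in> dual_group" for \<gamma>
  proof (cases "?T \<gamma> \<le> e * ?N")
    case True
    have "?T \<gamma> ^ 4 = ?T \<gamma> ^ 2 * ?T \<gamma> ^ 2" by (simp flip: power_add)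
    also have "\<dots> \<le> (e * ?N)\<^sup>2 * ?T \<gamma> ^ 2"
      using True by (intro mult_right_mono power_mono) auto
    finally show ?thesis using W by (simp add: add_increasing2)
  next
    case False
    have "?T \<gamma> ^ 4 \<le> ?N ^ 4" using norm_exp_sum_le[OF that] by (intro power_mono) auto
    also have "\<dots> = W * (e * ?N) powr q" using N e by (simp add: W_def)
    also have "\<dots> \<le> W * ?T \<gamma> powr q"
      using False W e N q by (intro mult_left_mono powr_mono2) auto
    finally show ?thesis by (simp add: add_increasing)
  qed
  have iq: "integrable \<mu> (\<lambda>\<gamma>. ?T \<gamma> powr q)" using q by (intro integrable_exp_sum_powr) simp
  have "?N ^ 3 / 27 / c \<le> real (energy E) / c" using en c_pos by (intro divide_right_mono) auto
  also have "\<dots> = (\<integral>\<gamma>. ?T \<gamma> ^ 4 \<partial>\<mu>)" using fourth_moment[OF E(1)] by simp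
  also have "\<dots> \<le> (\<integral>\<gamma>. (e * ?N)\<^sup>2 * ?T \<gamma> ^ 2 + W * ?T \<gamma> powr q \<partial>\<mu>)"
    by (rule integral_mono) (use pw in \<open>auto simp: integrable_exp_sum_power iq\<close>)
  also have "\<dots> = (e * ?N)\<^sup>2 * (\<integral>\<gamma>. ?T \<gamma> ^ 2 \<partial>\<mu>) + W * (\<integral>\<gamma>. ?T \<gamma> powr q \<partial>\<mu>)"
    by (simp add: integrable_exp_sum_power iq)
  also have "(e * ?N)\<^sup>2 * (\<integral>\<gamma>. ?T \<gamma> ^ 2 \<partial>\<mu>) = ?N ^ 3 / 54 / c"
    unfolding second_moment[OF E(1)] power_mult_distrib e(2)
    by (simp add: power2_eq_square power3_eq_cube)
  finally have "?N ^ 3 / 54 / c \<le> W * (\<integral>\<gamma>. ?T \<gamma> powr q \<partial>\<mu>)" by (simp add: field_simps)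
  then have "?N ^ 3 / 54 / c \<le> (\<integral>\<gamma>. ?T \<gamma> powr q \<partial>\<mu>) * W" by (simp only: mult.commute)
  then have "?N ^ 3 / 54 / c / W \<le> (\<integral>\<gamma>. ?T \<gamma> powr q \<partial>\<mu>)"
    by (rule pos_divide_le_eq[OF W, THEN iffD2])
  moreover have "?N ^ 3 / 54 / c / W = (1 / 54) powr (q / 2) / (54 * c) * ?N powr (q - 1)"
  proof -
    have "e powr q = (1 / 54) powr (q / 2)"
      by (simp add: e_def powr_half_sqrt[symmetric] powr_powr del: real_sqrt_divide)
    moreover have "?N powr q = ?N * ?N powr (q - 1)" using N powr_add[of ?N 1 "q - 1"] by simp
    ultimately show ?thesis
      using N e by (simp add: W_def powr_mult power3_eq_cube power4_eq_xxxx field_simps)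
  qed
  ultimately show ?thesis by simp
qed

lemma Cpq_infinite_energy:
  assumes inf: "infinite (UNIV :: 'a set)" and a: "0 \<le> a" and b: "0 \<le> b" "b < 1 / 2" "a + b < 1"
  shows "Cpq c \<mu> a b = \<infinity>"
proof -
  \<comment> \<open>The moment argument needs a positive reciprocal exponent, so b = 0 is replaced
    by a small \<open>b'\<close>; half of 1 - a keeps a + b' < 1 strict.\<close>
  obtain b' where b': "0 < b'" "b \<le> b'" "b' < 1 / 2" "a + b' < 1"
  proof (cases "b = 0")
    case True
    then show ?thesis using that[of "min (1 / 4) ((1 - a) / 2)"] b by (auto simp: min_def field_simps)
  next
    case False
    then show ?thesis using that[of b] b by simp
  qed
  define q where "q = 1 / b'"
  have q: "q > 2" using b' by (simp add: q_def field_simps)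
  define \<kappa> where "\<kappa> = (1 / 54) powr (q / 2) / (54 * c)"
  have \<kappa>: "\<kappa> > 0" using c_pos by (simp add: \<kappa>_def)
  show ?thesis
  proof (rule powr_unbounded_imp_top)
    show "c * c powr (- a) * \<kappa> powr b' > 0" using c_pos \<kappa> by simp
    show "1 - a - b' > 0" using b' by simp
    fix n
    obtain E :: "'a set" where E: "finite E" "n \<le> card E" "card E > 0" "real (card E) ^ 3 / 27 \<le> real (energy E)"
      using high_energy_exists[OF inf, of n] by blast
    let ?N = "real (card E)"
    have ne: "E \<noteq> {}" and N: "?N > 0" using E by auto
    let ?k = "c * (c * ?N) powr (- a)"
    have "ennreal (?k * (\<kappa> * ?N powr (q - 1)) powr b') \<le> Lnorm \<mu> b' (\<lambda>\<gamma>. of_real ?k * exp_sum E \<gamma>)"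
      using high_moment_ge[OF E(1) ne q E(4)] c_pos b' \<kappa>
      by (intro Lnorm_exp_sum_geI) (auto simp: q_def \<kappa>_def)
    also have "\<dots> \<le> ennreal ((1 / c) powr (b' - b)) * Cpq c \<mu> a b"
      by (rule Lnorm_exp_sum_le_Cpq) (use E ne a b b' in auto)
    also have "?k * (\<kappa> * ?N powr (q - 1)) powr b' = c * c powr (- a) * \<kappa> powr b' * ?N powr (1 - a - b')"
    proof -
      \<comment> \<open>Hence the norm of the exponential sum grows at least like N^(1-b'), and the
        normalization N^(-a) leaves the positive exponent 1 - a - b'.\<close>
      have "(q - 1) * b' = 1 - b'" using b' by (simp add: q_def field_simps)
      then have "(\<kappa> * ?N powr (q - 1)) powr b' = \<kappa> powr b' * ?N powr (1 - b')"
        by (simp only: powr_mult powr_powr)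
      moreover have "(c * ?N) powr (- a) = c powr (- a) * ?N powr (- a)" by (rule powr_mult)
      moreover have "?N powr (1 - a - b') = ?N powr (- a) * ?N powr (1 - b')"
        by (simp add: algebra_simps flip: powr_add)
      ultimately show ?thesis by simp
    qed
    finally show "\<exists>N\<ge>n. ennreal (c * c powr (- a) * \<kappa> powr b' * real N powr (1 - a - b'))
        \<le> ennreal ((1 / c) powr (b' - b)) * Cpq c \<mu> a b"
      using E by (intro exI[of _ "card E"]) simp
  qed
qed

end

theorem theorem4p1:
  fixes c :: real and \<mu> :: "('a::ab_group_add \<Rightarrow> complex) measure" and a b :: real
  assumes "infinite (UNIV :: 'a set)"
    and "c > 0"
    and "is_dual_haar c \<mu>"
    and "a \<ge> 0" and "b \<ge> 0"
  shows "((a + b < 1 \<and> b < 1/2) \<or> (a \<le> 1 \<and> b \<le> 1 \<and> a < 1/2 \<and> b \<ge> 1/2)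
            \<longrightarrow> Cpq c \<mu> a b = \<infinity>)
       \<and> (a + b \<ge> 1 \<and> a \<ge> 1/2 \<longrightarrow> Cpq c \<mu> a b = ennreal ((1 / c) powr (a + b - 1)))"
proof -
  interpret dual_haar c \<mu> using assms by unfold_locales
  show ?thesis
    using Cpq_infinite_energy[OF assms(1), of a b] Cpq_infinite_sidon[OF assms(1), of a b]
      Cpq_eq[of a b] assms by auto
qed

end
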